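(* Let $e\geq2$ and $n\geq1$ be integers. The cardinality of $NCP(e,1,n)$ (resp. of $NCP(e,e,n+1)$) is the Catalan number attached to $G(e,1,n)$ (resp. to $G(e,e,n+1)$).
   Context: $\mu_d\subset\mathbb{C}$ is the group of $d$-th roots of unity. For finite $x\subset\mathbb{C}$, $NCP_x$ is the set of partitions of $x$ such that any two parts whose convex hulls intersect are equal. $NCP(e,1,n)$ is the set of elements of $NCP_{\mu_{en}}$ invariant under multiplication by $\mu_e$. $NCP(e,e,n+1)$ is the set of $u\in NCP_{\mu_{en}\cup\{0\}}$ whose restriction to $\mu_{en}$ (forgetting $0$) lies in $NCP(e,1,n)$. The Catalan number attached to a reflection group with reflection degrees $d_1,\dots,d_r$, of which the largest is $h$, is $\prod_{i=1}^r\frac{d_i+h}{d_i}$. $G(e,1,n)$ is the group of $n\times n$ monomial matrices with non-zero entries in $\mu_e$, with reflection degrees $e,2e,\dots,(n-1)e,ne$. $G(e,e,n+1)$ is the group of $(n+1)\times(n+1)$ monomial matrices with non-zero entries in $\mu_e$ whose product is $1$, with reflection degrees $e,2e,\dots,(n-1)e,ne,n+1$. In both cases $h=en$. *)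

theory Defs
  imports "HOL-Analysis.Analysis" "HOL-Library.Disjoint_Sets"
begin

definition mu :: "nat \<Rightarrow> complex set" where
  "mu d = {z. z ^ d = 1}"

definition NCP :: "complex set \<Rightarrow> complex set set set" where
  "NCP x = {u. partition_on x u \<and>
     (\<forall>P\<in>u. \<forall>Q\<in>u. convex hull P \<inter> convex hull Q \<noteq> {} \<longrightarrow> P = Q)}"

text \<open>A root of unity acts on a partition by acting on each of its parts.\<close>

definition NCP_e1 :: "nat \<Rightarrow> nat \<Rightarrow> complex set set set" where
  "NCP_e1 e n = {u \<in> NCP (mu (e * n)). \<forall>\<zeta>\<in>mu e. (\<lambda>P. (\<lambda>z. \<zeta> * z) ` P) ` u = u}"

definition restrict_partition :: "'a set set \<Rightarrow> 'a set \<Rightarrow> 'a set set" where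
  "restrict_partition u y = (\<lambda>P. P \<inter> y) ` u - {{}}"

text \<open>With parameters \<open>e\<close> and \<open>n\<close>, this is \<open>NCP(e,e,n+1)\<close>.\<close>

definition NCP_ee :: "nat \<Rightarrow> nat \<Rightarrow> complex set set set" where
  "NCP_ee e n = {u \<in> NCP (mu (e * n) \<union> {0}). restrict_partition u (mu (e * n)) \<in> NCP_e1 e n}"

text \<open>
  The Catalan number of a reflection group depends on the group only through its list \<open>ds\<close> of
  reflection degrees. The degrees of \<open>G(e,1,n)\<close>, the monomial \<open>n \<times> n\<close> matrices with
  non-zero entries in \<open>mu e\<close>, and of \<open>G(e,e,n+1)\<close>, the monomial \<open>(n+1) \<times> (n+1)\<close> matrices
  with non-zero entries in \<open>mu e\<close> of product \<open>1\<close>, are the classical ones of Shephard and Todd.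
\<close>

definition catalan_of_degrees :: "nat list \<Rightarrow> rat" where
  "catalan_of_degrees ds = (\<Prod>d\<leftarrow>ds. of_nat (d + Max (set ds)) / of_nat d)"

definition degrees_G_e1 :: "nat \<Rightarrow> nat \<Rightarrow> nat list" where
  "degrees_G_e1 e n = map (\<lambda>i. i * e) [1..<n + 1]"

text \<open>With parameters \<open>e\<close> and \<open>n\<close>, these are the degrees of \<open>G(e,e,n+1)\<close>.\<close>

definition degrees_G_ee :: "nat \<Rightarrow> nat \<Rightarrow> nat list" where
  "degrees_G_ee e n = map (\<lambda>i. i * e) [1..<n + 1] @ [n + 1]"

end

theory Submission
  imports Defs
begin

text \<open>
  Number the \<open>en\<close>-th roots of unity by integers. In a noncrossing partition invariant under
  \<open>\<mu>\<^sub>e\<close>, record for each residue modulo \<open>n\<close> whether it has a predecessor in its part (set \<open>X\<close>)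
  and whether it has a successor (set \<open>Y\<close>). Links from an element to its successor match opening
  with closing brackets, so \<open>|X| = |Y|\<close>, and conversely every periodic word with as many opening as
  closing brackets has a unique matching. Hence \<open>NCP(e,1,n)\<close> has
  \<open>\<Sum>\<^sub>k (n choose k)\<^sup>2 = 2n choose n\<close> elements.

  The point 0 must join the part around the origin if there is one. Otherwise it is alone or joins
  a part visible from 0. The last element \<open>p\<close> of that part is followed by a gap of minimal
  nesting level. Adding \<open>p\<close> to \<open>Y\<close> gives a pair with \<open>|Y| = |X| + 1\<close>, and by the cycle
  lemma \<open>p\<close> is recovered modulo \<open>n\<close> from such a pair. As \<open>p\<close> has \<open>e\<close> lifts, this adds
  \<open>e (2n choose n-1)\<close> elements.
\<close>

subsection \<open>Periodic bracket words\<close>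

text \<open>Matching brackets needs a linear order, but the roots lie on a circle. Hence everything
  is pulled back to the integers, to relations of period \<open>e * n\<close> that are also
  invariant under the shift by \<open>n\<close>. A word depends only on residues modulo
  \<open>n\<close>; its nesting level is periodic when the word is balanced, and \<open>E\<close>
  knows nothing of \<open>e\<close>. The full turn \<open>e * n\<close> enters when \<open>E\<close>
  is folded back onto the circle. The hypothesis \<open>e \<ge> 2\<close> makes the folding
  harmless. Links have length at most \<open>n\<close>, so two interleaving links fit in one turn,
  which lets noncrossing be applied to them. Links shorter than \<open>n\<close> subtend less than
  half a turn, so visibility from 0 can be read off the word. Geometry enters through few facts:
  interleaved chords meet, a short chord meets the radii to the points of its arc, a line separates
  an arc from its complement (with 0 on the far side if the arc is shorter than half a turn), and an
  orbit of rotations has barycentre 0.\<close>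

locale word =
  fixes n :: int and X Y :: "int set"
  assumes n_pos: "0 < n" and X_sub: "X \<subseteq> {0..<n}" and Y_sub: "Y \<subseteq> {0..<n}"
begin

definition step :: "int \<Rightarrow> int" where
  "step k = of_bool (k mod n \<in> Y) - of_bool (k mod n \<in> X)"

text \<open>Read each integer in turn as a closing bracket if its residue lies in \<open>X\<close>, followed by an
  opening bracket if its residue lies in \<open>Y\<close>. Then \<open>H i\<close> is the nesting level just before \<open>i\<close>, and
  \<open>M i\<close> is the level between the two brackets at \<open>i\<close>. The relation \<open>E\<close> joins integers linked by
  chains of matching brackets; an infinite chain becomes the part around the origin.\<close>

definition H :: "int \<Rightarrow> int" where
  "H i = sum step {0..<i} - sum step {i..<0}"

definition M :: "int \<Rightarrow> int" where
  "M i = H i - of_bool (i mod n \<in> X)"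

definition E :: "int \<Rightarrow> int \<Rightarrow> bool" where
  "E i j \<longleftrightarrow> M i = M j \<and> (\<forall>g. min i j < g \<and> g \<le> max i j \<longrightarrow> M i < H g)"

lemma H_Suc: "H (i + 1) = H i + step i"
proof (cases "0 \<le> i")
  case True
  then have "{0..<i+1} = insert i {0..<i}" "{i..<0} = {}" "{i+1..<0} = {}" by auto
  then show ?thesis by (simp add: H_def)
next
  case False
  then have "{i..<0} = insert i {i+1..<0}" "{0..<i} = {}" "{0..<i+1} = {}" by auto
  then show ?thesis by (simp add: H_def)
qed

lemma H_M: "H (i + 1) = M i + of_bool (i mod n \<in> Y)"
  by (simp add: H_Suc M_def step_def)

lemma M_le_H: "M i \<le> H i" and H_le_M: "H i \<le> M i + 1"
  and M_le_H_Suc: "M i \<le> H (i + 1)" and H_Suc_le_M: "H (i + 1) \<le> M i + 1"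
  by (simp_all add: H_M) (simp_all add: M_def)

lemma M_pred_le_H: "M (i - 1) \<le> H i"
  using M_le_H_Suc[of "i - 1"] by simp

lemma H_diff: "i \<le> j \<Longrightarrow> H j - H i = sum step {i..<j}"
proof (induction j rule: int_ge_induct)
  case (step j)
  then have "{i..<j+1} = insert j {i..<j}" by auto
  with step show ?case by (simp add: H_Suc)
qed simp

lemma H_add_period: "H (i + n) = H i + int (card Y) - int (card X)"
proof -
  have *: "H (i + n) - H i = H n - H 0" for i
  proof (induction i rule: int_induct[where k = 0])
    case (step1 i)
    have "H (i + 1 + n) = H (i + n) + step (i + n)"
      using H_Suc[of "i + n"] by (simp add: algebra_simps)
    moreover have "step (i + n) = step i" by (simp add: step_def)
    ultimately show ?case using step1 H_Suc[of i] by simp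
  next
    case (step2 i)
    have "H (i + n) = H (i - 1 + n) + step (i - 1 + n)"
      using H_Suc[of "i - 1 + n"] by (simp add: algebra_simps)
    moreover have "step (i - 1 + n) = step (i - 1)"
      using mod_add_self2[of "i - 1" n] by (simp add: step_def)
    ultimately show ?case using step2 H_Suc[of "i - 1"] by simp
  qed simp
  have eq: "sum (\<lambda>k. of_bool (k mod n \<in> Z)) {0..<n} = int (card Z)" if "Z \<subseteq> {0..<n}" for Z
  proof -
    have "sum (\<lambda>k. of_bool (k mod n \<in> Z)) {0..<n} = (sum (\<lambda>k. of_bool (k \<in> Z)) {0..<n} :: int)"
      by (rule sum.cong) auto
    also have "\<dots> = int (card Z)"
      using that by (simp add: Int_absorb1 flip: Int_def)
    finally show ?thesis .
  qed
  have "H n - H 0 = sum step {0..<n}" using H_diff[of 0 n] n_pos by simp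
  also have "\<dots> = int (card Y) - int (card X)"
    unfolding step_def by (simp only: sum_subtractf eq[OF X_sub] eq[OF Y_sub])
  finally show ?thesis using *[of i] by simp
qed

lemma H_add_mult: "H (i + k * n) = H i + k * (int (card Y) - int (card X))"
proof (induction k rule: int_induct[where k = 0])
  case (step1 k)
  then show ?case using H_add_period[of "i + k * n"] by (simp add: algebra_simps)
next
  case (step2 k)
  then show ?case using H_add_period[of "i + (k - 1) * n"] by (simp add: algebra_simps)
qed simp

lemma M_add_mult: "M (i + k * n) = M i + k * (int (card Y) - int (card X))"
  by (simp add: M_def H_add_mult)

lemma E_refl: "E i i"
  by (simp add: E_def)

lemma E_sym: "E i j \<Longrightarrow> E j i"
  unfolding E_def by (metis min.commute max.commute)

lemma E_trans:
  assumes "E i j" "E j k"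
  shows "E i k"
  unfolding E_def
proof (intro conjI allI impI)
  show "M i = M k" using assms by (simp add: E_def)
  fix g assume "min i k < g \<and> g \<le> max i k"
  then consider "min i j < g" "g \<le> max i j" | "min j k < g" "g \<le> max j k" by linarith
  then show "M i < H g" using assms by cases (auto simp: E_def)
qed

text \<open>Since \<open>H\<close> exceeds \<open>M\<close> by at most one at the same position, the
  strict inequalities at \<open>b\<close> and \<open>c\<close> give \<open>M a \<le> M b\<close> and
  \<open>M b \<le> M c\<close>; as \<open>M c = M a\<close>, all three levels agree.\<close>

lemma E_cross:
  assumes "a < b" "b < c" "c < d" "E a c" "E b d"
  shows "E a b"
proof -
  have "M a < H b" "M b < H c" using assms by (auto simp: E_def)
  then have "M a \<le> M b" "M b \<le> M c" using H_le_M[of b] H_le_M[of c] by linarith+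
  then show ?thesis using assms by (auto simp: E_def)
qed

end

section \<open>Balanced words: periodic levels and the matching of brackets\<close>

locale balanced_word = word +
  assumes balanced: "card X = card Y"
begin

lemma H_periodic: "H (i + k * n) = H i" and M_periodic: "M (i + k * n) = M i"
  by (simp_all add: H_add_mult M_add_mult balanced)

lemma E_add_mult: "E (i + k * n) (j + k * n) \<longleftrightarrow> E i j"
proof -
  have *: "E (i + k * n) (j + k * n)" if "E i j" for i j k
    unfolding E_def
  proof (intro conjI allI impI)
    show "M (i + k * n) = M (j + k * n)" using that by (simp add: M_periodic E_def)
    fix g assume "min (i + k * n) (j + k * n) < g \<and> g \<le> max (i + k * n) (j + k * n)"
    then have "min i j < g - k * n \<and> g - k * n \<le> max i j" by auto
    then have "M i < H (g - k * n)" using that by (auto simp: E_def)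
    then show "M (i + k * n) < H g" using H_periodic[of "g - k * n" k] by (simp add: M_periodic)
  qed
  show ?thesis using *[of i j k] *[of "i + k * n" "j + k * n" "- k"] by auto
qed

lemma E_far: "E i j \<Longrightarrow> i + n \<le> j \<Longrightarrow> E i (i + n)"
  using M_periodic[of i 1] n_pos by (auto simp: E_def)

text \<open>The window \<open>{i<..i + n}\<close> contains every residue, so by periodicity a bound
  that holds on it holds everywhere.\<close>

lemma E_central_gap:
  assumes "E i (i + n)"
  shows "M i < H g"
proof -
  define k where "k = (g - i - 1) div n"
  have "g - k * n - i - 1 = (g - i - 1) mod n"
    unfolding k_def using minus_div_mult_eq_mod[of "g - i - 1" n] by simp
  then have "0 \<le> g - k * n - i - 1" "g - k * n - i - 1 < n" using n_pos by auto
  then have "M i < H (g - k * n)" using assms by (auto simp: E_def)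
  then show ?thesis using H_periodic[of "g - k * n" k] by simp
qed

lemma E_central: "E i (i + n) \<Longrightarrow> E i (i + k * n)"
  using E_central_gap[of i] M_periodic[of i k] by (auto simp: E_def[of _ "i + k * n"])

text \<open>The match is the first later position whose level \<open>M\<close> is at most
  \<open>M i\<close>. Periodicity makes \<open>i + n\<close> a candidate, whence the bound on the
  length; the level cannot drop below \<open>M i\<close> there because a closing bracket costs only
  one.\<close>

lemma open_imp_arc:
  assumes "i mod n \<in> Y"
  shows "\<exists>j. i < j \<and> j \<le> i + n \<and> E i j"
proof -
  define A where "A = {j \<in> {i<..i+n}. M j \<le> M i}"
  have "i + n \<in> A" using n_pos M_periodic[of i 1] by (simp add: A_def)
  moreover have "finite A" by (rule finite_subset[of _ "{i<..i+n}"]) (auto simp: A_def)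
  ultimately have *: "Min A \<in> A" "\<And>k. k \<in> A \<Longrightarrow> Min A \<le> k" by (auto intro: Min_in)
  define j where "j = Min A"
  have j: "i < j" "j \<le> i + n" "M j \<le> M i" using *(1) by (auto simp: A_def j_def)
  have low: "M i < M k" if "i < k" "k < j" for k
    using *(2)[of k] that j by (force simp: A_def j_def)
  have gap: "M i < H g" if "i < g" "g \<le> j" for g
  proof (cases "g = i + 1")
    case True then show ?thesis using assms by (simp add: H_M)
  next
    case False then show ?thesis using low[of "g - 1"] that M_pred_le_H[of g] by simp
  qed
  have "M i < H j" using gap j by auto
  then have "M i = M j" using j H_le_M[of j] by simp
  then have "E i j" using gap j by (auto simp: E_def)
  then show ?thesis using j by blast
qed

lemma close_imp_arc:
  assumes "i mod n \<in> X"
  shows "\<exists>j. i - n \<le> j \<and> j < i \<and> E j i"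
proof -
  define A where "A = {j \<in> {i-n..<i}. M j \<le> M i}"
  have "i - n \<in> A" using n_pos M_periodic[of i "-1"] by (simp add: A_def)
  moreover have "finite A" by (rule finite_subset[of _ "{i-n..<i}"]) (auto simp: A_def)
  ultimately have *: "Max A \<in> A" "\<And>k. k \<in> A \<Longrightarrow> k \<le> Max A" by (auto intro: Max_in)
  define j where "j = Max A"
  have j: "i - n \<le> j" "j < i" "M j \<le> M i" using *(1) by (auto simp: A_def j_def)
  have low: "M i < M k" if "j < k" "k < i" for k
    using *(2)[of k] that j by (force simp: A_def j_def)
  have gap: "M i < H g" if "j < g" "g \<le> i" for g
  proof (cases "g = i")
    case True then show ?thesis using assms by (simp add: M_def)
  next
    case False then show ?thesis using low[of g] that M_le_H[of g] by simp
  qed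
  have "M i < H (j + 1)" using gap j by auto
  then have "M i = M j" using j H_Suc_le_M[of j] by simp
  then have "E j i" using gap j by (auto simp: E_def)
  then show ?thesis using j by blast
qed

lemma arc_imp_open: "E i j \<Longrightarrow> i < j \<Longrightarrow> i mod n \<in> Y"
  using H_M[of i] by (cases "i mod n \<in> Y") (auto simp: E_def dest: spec[of _ "i + 1"])

lemma arc_imp_close: "E j i \<Longrightarrow> j < i \<Longrightarrow> i mod n \<in> X"
  using M_def[of i] by (auto simp: E_def split: if_splits)

text \<open>\<open>H (p + 1)\<close> is the level of the gap between \<open>p\<close> and
  \<open>p + 1\<close>, and a link across this gap has a lower \<open>M\<close>. Conversely, if a
  lower \<open>M\<close> occurs anywhere, the nearest such positions to the left and to the right of
  the gap are linked.\<close>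

lemma minimal_gap_iff:
  "(\<forall>i. H (p + 1) \<le> M i) \<longleftrightarrow> (\<forall>a b. a \<le> p \<longrightarrow> p < b \<longrightarrow> b \<le> a + n \<longrightarrow> \<not> E a b)"
proof
  assume L: "\<forall>i. H (p + 1) \<le> M i"
  show "\<forall>a b. a \<le> p \<longrightarrow> p < b \<longrightarrow> b \<le> a + n \<longrightarrow> \<not> E a b"
  proof (intro allI impI notI)
    fix a b assume "a \<le> p" "p < b" "E a b"
    then have "M a < H (p + 1)" by (auto simp: E_def dest: spec[of _ "p + 1"])
    then show False using L by (simp add: not_le[symmetric])
  qed
next
  assume R: "\<forall>a b. a \<le> p \<longrightarrow> p < b \<longrightarrow> b \<le> a + n \<longrightarrow> \<not> E a b"
  show "\<forall>i. H (p + 1) \<le> M i"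
  proof (rule ccontr)
    assume "\<not> (\<forall>i. H (p + 1) \<le> M i)"
    then obtain i where i: "M i < H (p + 1)" by (auto simp: not_le)
    \<comment> \<open>A translate of \<open>i\<close> in the period after the gap; shifting it back
      by \<open>n\<close> lands in the period before, so both candidate sets below are
      nonempty.\<close>
    define i' where "i' = i - ((i - p - 1) div n) * n"
    have "i' - p - 1 = (i - p - 1) mod n"
      unfolding i'_def using minus_div_mult_eq_mod[of "i - p - 1" n] by simp
    then have i': "p < i'" "i' \<le> p + n"
      using pos_mod_bound[OF n_pos, of "i - p - 1"] pos_mod_sign[OF n_pos, of "i - p - 1"] by linarith+
    have Mi': "M i' < H (p + 1)"
      using i M_periodic[of i "- ((i - p - 1) div n)"] by (simp add: i'_def)
    have Mi'n: "M (i' - n) < H (p + 1)" using Mi' M_periodic[of i' "-1"] by simp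
    define A where "A = {j \<in> {p-n<..p}. M j < H (p + 1)}"
    define B where "B = {j \<in> {p<..p+n}. M j < H (p + 1)}"
    have "finite A" by (rule finite_subset[of _ "{p-n<..p}"]) (auto simp: A_def)
    moreover have "finite B" by (rule finite_subset[of _ "{p<..p+n}"]) (auto simp: B_def)
    moreover have "i' - n \<in> A" "i' \<in> B"
      using i' Mi' Mi'n by (auto simp: A_def B_def)
    ultimately have A: "Max A \<in> A" "\<And>k. k \<in> A \<Longrightarrow> k \<le> Max A"
      and B: "Min B \<in> B" "\<And>k. k \<in> B \<Longrightarrow> Min B \<le> k"
      by (auto intro: Max_in Min_in)
    define a where "a = Max A"
    define b where "b = Min B"
    have a: "p - n < a" "a \<le> p" "M a < H (p + 1)" using A(1) by (auto simp: A_def a_def)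
    have b: "p < b" "b \<le> p + n" "M b < H (p + 1)" using B(1) by (auto simp: B_def b_def)
    have "a + n \<in> B" using a M_periodic[of a 1] by (auto simp: B_def)
    then have ban: "b \<le> a + n" using B(2) b_def by auto
    have low: "H (p + 1) \<le> M k" if "a < k" "k < b" for k
    proof (cases "k \<le> p")
      case True then show ?thesis using A(2)[of k] that a by (force simp: A_def a_def)
    next
      case False then show ?thesis using B(2)[of k] that b by (force simp: B_def b_def)
    qed
    have gap: "H (p + 1) \<le> H g" if "a < g" "g \<le> b" for g
    proof -
      consider "g \<le> p" | "g = p + 1" | "p + 1 < g" by linarith
      then show ?thesis
      proof cases
        case 1 then show ?thesis using low[of g] that b M_le_H[of g] by simp
      next
        case 3 then show ?thesis using low[of "g - 1"] that a M_pred_le_H[of g] by simp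
      qed simp
    qed
    \<comment> \<open>Levels change by at most one at a bracket, which pins both \<open>M a\<close>
      and \<open>M b\<close> to \<open>H (p + 1) - 1\<close>.\<close>
    have "H (p + 1) \<le> H (a + 1)" "H (p + 1) \<le> H b" using gap[of "a+1"] gap[of b] a b by auto
    then have "M a = M b" "M a < H (p + 1)"
      using H_Suc_le_M[of a] H_le_M[of b] a b by linarith+
    then have "E a b" using gap a b by (fastforce simp: E_def)
    then show False using R a b ban by auto
  qed
qed

end

subsection \<open>Noncrossing periodic equivalence relations\<close>

text \<open>An invariant noncrossing partition pulled back to the integers: \<open>r_period\<close>
  identifies indices of the same root, \<open>r_shift\<close> is rotation by a generator of the
  acting group, and \<open>r_cross\<close> concerns four points of one turn.\<close>

locale ncrel =
  fixes e n :: int and r :: "int \<Rightarrow> int \<Rightarrow> bool"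
  assumes e_ge: "2 \<le> e" and n_pos: "0 < n"
    and r_refl: "r i i"
    and r_sym: "r i j \<Longrightarrow> r j i"
    and r_trans: "r i j \<Longrightarrow> r j k \<Longrightarrow> r i k"
    and r_period: "r i (i + e * n)"
    and r_shift: "r i j \<Longrightarrow> r (i + n) (j + n)"
    and r_cross: "a < b \<Longrightarrow> b < c \<Longrightarrow> c < d \<Longrightarrow> d < a + e * n \<Longrightarrow> r a c \<Longrightarrow> r b d \<Longrightarrow> r a b"
begin

text \<open>By \<open>r_period\<close> every integer has later relatives. The bound \<open>n\<close>
  keeps the genuine successors: a part away from the origin fits in a window shorter than
  \<open>n\<close>, and a part around it is mapped to itself by the shift by
  \<open>n\<close>.\<close>

definition opn :: "int \<Rightarrow> bool" where
  "opn i \<longleftrightarrow> (\<exists>j. i < j \<and> j \<le> i + n \<and> r i j)"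

definition cls :: "int \<Rightarrow> bool" where
  "cls i \<longleftrightarrow> (\<exists>j. i - n \<le> j \<and> j < i \<and> r j i)"

definition X :: "int set" where "X = {i \<in> {0..<n}. cls i}"
definition Y :: "int set" where "Y = {i \<in> {0..<n}. opn i}"

lemma two_n_le: "2 * n \<le> e * n"
  using e_ge n_pos by simp

text \<open>This is how \<open>e \<ge> 2\<close> supplies the one-turn premise of
  \<open>r_cross\<close> for two interleaving links of length at most \<open>n\<close>.\<close>

lemma less_add_period: "j < i + 2 * n \<Longrightarrow> j < i + e * n"
  using order_less_le_trans[OF _ add_left_mono[OF two_n_le]] .

lemma r_period_mult: "r i (i + k * (e * n))"
proof (induction k rule: int_induct[where k = 0])
  case (step1 k)
  have "i + (k + 1) * (e * n) = i + k * (e * n) + e * n" by (simp add: algebra_simps)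
  then show ?case using step1 r_period r_trans by metis
next
  case (step2 k)
  have "i + k * (e * n) = i + (k - 1) * (e * n) + e * n" by (simp add: algebra_simps)
  then show ?case using step2 r_period r_sym r_trans by metis
qed (simp add: r_refl)

lemma r_period_iff: "r i (j + k * (e * n)) \<longleftrightarrow> r i j"
  using r_period_mult r_sym r_trans by blast

lemma r_shift_mult: "r (i + k * n) (j + k * n) \<longleftrightarrow> r i j"
proof -
  have nat: "r i j \<Longrightarrow> r (i + int m * n) (j + int m * n)" for i j m
  proof (induction m)
    case (Suc m)
    then show ?case using r_shift[of "i + int m * n" "j + int m * n"] by (simp add: algebra_simps)
  qed simp
  have *: "r (i + k * n) (j + k * n)" if "r i j" for i j k
  proof -
    \<comment> \<open>A possibly negative shift is replaced by a nonnegative one that differs from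
      it by \<open>\<bar>k\<bar>\<close> full turns, which \<open>r\<close> does not see.\<close>
    define m where "m = nat (k + \<bar>k\<bar> * e)"
    have "0 \<le> k + \<bar>k\<bar> * e" using e_ge mult_left_mono[of 1 e "\<bar>k\<bar>"] by simp
    then have m: "i + int m * n = i + k * n + \<bar>k\<bar> * (e * n)" for i
      by (simp add: m_def algebra_simps)
    have "r (i + int m * n) (j + int m * n)" using nat[OF that] .
    then show ?thesis unfolding m by (meson r_period_mult r_sym r_trans)
  qed
  show ?thesis using *[of i j k] *[of "i + k * n" "j + k * n" "- k"] by auto
qed

lemma opn_shift_mult: "opn (i + k * n) \<longleftrightarrow> opn i"
proof -
  have *: "opn (i + k * n)" if o: "opn i" for i k
  proof -
    obtain j where "i < j" "j \<le> i + n" "r i j" using o by (auto simp: opn_def)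
    then show ?thesis unfolding opn_def by (intro exI[of _ "j + k * n"]) (simp add: r_shift_mult)
  qed
  show ?thesis using *[of i k] *[of "i + k * n" "- k"] by auto
qed

lemma cls_shift_mult: "cls (i + k * n) \<longleftrightarrow> cls i"
proof -
  have *: "cls (i + k * n)" if c: "cls i" for i k
  proof -
    obtain j where "i - n \<le> j" "j < i" "r j i" using c by (auto simp: cls_def)
    then show ?thesis unfolding cls_def by (intro exI[of _ "j + k * n"]) (simp add: r_shift_mult)
  qed
  show ?thesis using *[of i k] *[of "i + k * n" "- k"] by auto
qed

lemma mod_in_Y: "i mod n \<in> Y \<longleftrightarrow> opn i"
  using n_pos opn_shift_mult[of "i mod n" "i div n"] by (simp add: Y_def)

lemma mod_in_X: "i mod n \<in> X \<longleftrightarrow> cls i"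
  using n_pos cls_shift_mult[of "i mod n" "i div n"] by (simp add: X_def)

sublocale w: word n X Y
  by standard (auto simp: n_pos X_def Y_def)

lemma next_exists:
  assumes "opn i"
  obtains l where "i < l" "l \<le> i + n" "r i l" "\<And>k. i < k \<Longrightarrow> k < l \<Longrightarrow> \<not> r i k"
proof -
  define A where "A = {l \<in> {i<..i+n}. r i l}"
  have "finite A" by (rule finite_subset[of _ "{i<..i+n}"]) (auto simp: A_def)
  moreover have "A \<noteq> {}" using assms by (auto simp: A_def opn_def)
  ultimately have *: "Min A \<in> A" "\<And>k. k \<in> A \<Longrightarrow> Min A \<le> k" by (auto intro: Min_in)
  define l where "l = Min A"
  have l: "i < l" "l \<le> i + n" "r i l" using *(1) by (auto simp: A_def l_def)
  have "\<not> r i k" if "i < k" "k < l" for k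
  proof
    assume "r i k"
    then have "k \<in> A" using l that by (simp add: A_def)
    then show False using *(2)[of k] that by (auto simp: l_def)
  qed
  then show ?thesis using that l by blast
qed

lemma prev_exists:
  assumes "cls i"
  obtains l where "i - n \<le> l" "l < i" "r l i" "\<And>k. l < k \<Longrightarrow> k < i \<Longrightarrow> \<not> r k i"
proof -
  define A where "A = {l \<in> {i-n..<i}. r l i}"
  have "finite A" by (rule finite_subset[of _ "{i-n..<i}"]) (auto simp: A_def)
  moreover have "A \<noteq> {}" using assms by (auto simp: A_def cls_def)
  ultimately have *: "Max A \<in> A" "\<And>k. k \<in> A \<Longrightarrow> k \<le> Max A" by (auto intro: Max_in)
  define l where "l = Max A"
  have l: "i - n \<le> l" "l < i" "r l i" using *(1) by (auto simp: A_def l_def)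
  have "\<not> r k i" if "l < k" "k < i" for k
  proof
    assume "r k i"
    then have "k \<in> A" using l that by (simp add: A_def)
    then show False using *(2)[of k] that by (auto simp: l_def)
  qed
  then show ?thesis using that l by blast
qed

definition nxt :: "int \<Rightarrow> int" where
  "nxt i = (SOME l. i < l \<and> l \<le> i + n \<and> r i l \<and> (\<forall>k. i < k \<and> k < l \<longrightarrow> \<not> r i k))"

definition prv :: "int \<Rightarrow> int" where
  "prv i = (SOME l. i - n \<le> l \<and> l < i \<and> r l i \<and> (\<forall>k. l < k \<and> k < i \<longrightarrow> \<not> r k i))"

lemma nxt: "opn i \<Longrightarrow> i < nxt i \<and> nxt i \<le> i + n \<and> r i (nxt i) \<and> (\<forall>k. i < k \<and> k < nxt i \<longrightarrow> \<not> r i k)"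
  unfolding nxt_def by (rule someI_ex) (metis next_exists)

lemma prv: "cls i \<Longrightarrow> i - n \<le> prv i \<and> prv i < i \<and> r (prv i) i \<and> (\<forall>k. prv i < k \<and> k < i \<longrightarrow> \<not> r k i)"
  unfolding prv_def by (rule someI_ex) (metis prev_exists)

lemma H_minus_M:
  assumes "i < g"
  shows "w.H g - w.M i = int (card {k \<in> {i..<g}. opn k}) - int (card {k \<in> {i<..<g}. cls k})"
proof -
  have "w.H g - w.H i = (\<Sum>k\<in>{i..<g}. of_bool (opn k)) - (\<Sum>k\<in>{i..<g}. of_bool (cls k))"
    using assms by (simp add: w.H_diff w.step_def mod_in_Y mod_in_X sum_subtractf)
  also have "(\<Sum>k\<in>{i..<g}. of_bool (cls k)) = (of_bool (cls i) :: int) + (\<Sum>k\<in>{i<..<g}. of_bool (cls k))"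
  proof -
    have "{i..<g} = insert i {i<..<g}" using assms by auto
    then show ?thesis by simp
  qed
  finally have "w.H g - w.H i = int (card {k \<in> {i..<g}. opn k})
      - (of_bool (cls i) + int (card {k \<in> {i<..<g}. cls k}))"
    by (simp add: Int_def)
  then show ?thesis
    by (cases "cls i") (simp_all add: w.M_def mod_in_X)
qed

text \<open>By \<open>H_minus_M\<close>, the opening positions in \<open>{i..<g}\<close> must
  outnumber the closing ones strictly between \<open>i\<close> and \<open>g\<close>. The map
  \<open>prv\<close> injects the latter into the former: a predecessor before \<open>i\<close> would
  cross the pair \<open>i\<close>, \<open>j\<close>, and then \<open>i\<close> would be a nearer
  one. The image misses \<open>l0\<close>, the last relative of \<open>i\<close> before
  \<open>g\<close>.\<close>

lemma M_less_H:
  assumes "r i j" "i < j" "j \<le> i + n" "i < g" "g \<le> j"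
  shows "w.M i < w.H g"
proof -
  define L where "L = {l \<in> {i..<g}. r i l}"
  have "finite L" by (rule finite_subset[of _ "{i..<g}"]) (auto simp: L_def)
  moreover have "i \<in> L" using assms by (simp add: L_def r_refl)
  ultimately have *: "Max L \<in> L" "\<And>k. k \<in> L \<Longrightarrow> k \<le> Max L" by (auto intro: Max_in)
  define l0 where "l0 = Max L"
  have l0: "i \<le> l0" "l0 < g" "r i l0" using * by (auto simp: L_def l0_def)
  have l0max: "k \<le> l0" if "i \<le> k" "k < g" "r i k" for k using * that by (auto simp: L_def l0_def)
  have "r l0 j" using l0 assms r_trans r_sym by blast
  then have "opn l0" unfolding opn_def using l0 assms by (intro exI[of _ j]) auto
  let ?C = "{k \<in> {i<..<g}. cls k}" and ?O = "{k \<in> {i..<g}. opn k}"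
  have p: "prv k \<in> ?O - {l0}" if k: "k \<in> ?C" for k
  proof -
    have pk: "k - n \<le> prv k" "prv k < k" "r (prv k) k" "\<And>m. prv k < m \<Longrightarrow> m < k \<Longrightarrow> \<not> r m k"
      using prv[of k] k by auto
    have "i \<le> prv k"
    proof (rule ccontr)
      assume a: "\<not> i \<le> prv k"
      have "r (prv k) i"
        by (rule r_cross[of "prv k" i k j]) (use a k assms pk in \<open>auto intro!: less_add_period\<close>)
      then have "r i k" using pk r_sym r_trans by blast
      then show False using pk(4)[of i] a k by auto
    qed
    moreover have "opn (prv k)" unfolding opn_def by (rule exI[of _ k]) (use pk in auto)
    moreover have "prv k \<noteq> l0"
    proof
      assume a: "prv k = l0"
      then have "r i k" using l0 pk r_trans by metis
      then show False using l0max[of k] a pk k by auto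
    qed
    ultimately show ?thesis using pk k by auto
  qed
  have inj: "inj_on prv ?C"
  proof (rule linorder_inj_onI')
    fix k k' assume k: "k \<in> ?C" "k' \<in> ?C" "k < k'"
    show "prv k \<noteq> prv k'"
    proof
      assume eq: "prv k = prv k'"
      moreover have "r (prv k) k" "r (prv k') k'" using prv k by auto
      ultimately have "r k k'" using r_sym r_trans by metis
      then show False using prv[of k] prv[of k'] k eq by auto
    qed
  qed
  have fin: "finite ?O" "finite ?C"
    by (auto intro: finite_subset[of _ "{i..<g}"])
  have "card ?C \<le> card (?O - {l0})"
    by (rule card_inj_on_le[OF inj]) (use p fin in auto)
  also have "\<dots> < card ?O"
    by (rule card_Diff1_less) (use fin l0 \<open>opn l0\<close> in auto)
  finally show ?thesis using H_minus_M[of i g] assms by simp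
qed

text \<open>The mirror count: \<open>nxt\<close> injects the opening positions in
  \<open>{i..<j}\<close> into the closing ones in \<open>{i<..j}\<close>, since a successor beyond
  \<open>j\<close> would cross the pair \<open>i\<close>, \<open>j\<close>.\<close>

lemma M_le_M:
  assumes "r i j" "i < j" "j \<le> i + n"
  shows "w.M j \<le> w.M i"
proof -
  let ?C = "{k \<in> {i<..j}. cls k}" and ?O = "{k \<in> {i..<j}. opn k}"
  have p: "nxt k \<in> ?C" if k: "k \<in> ?O" for k
  proof -
    have nk: "k < nxt k" "nxt k \<le> k + n" "r k (nxt k)" "\<And>m. k < m \<Longrightarrow> m < nxt k \<Longrightarrow> \<not> r k m"
      using nxt[of k] k by auto
    have "nxt k \<le> j"
    proof (rule ccontr)
      assume a: "\<not> nxt k \<le> j"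
      have "r i k"
      proof (cases "k = i")
        case False
        have "nxt k < i + e * n" using k nk(2) assms(3) by (intro less_add_period) simp
        then show ?thesis
          by (intro r_cross[of i k j "nxt k"]) (use False a k assms nk in auto)
      qed (simp add: r_refl)
      then have "r k j" using assms r_sym r_trans by blast
      then show False using nk(4)[of j] a k by auto
    qed
    moreover have "cls (nxt k)" unfolding cls_def by (rule exI[of _ k]) (use nk in auto)
    ultimately show ?thesis using nk k by auto
  qed
  have inj: "inj_on nxt ?O"
  proof (rule linorder_inj_onI')
    fix k k' assume k: "k \<in> ?O" "k' \<in> ?O" "k < k'"
    show "nxt k \<noteq> nxt k'"
    proof
      assume eq: "nxt k = nxt k'"
      moreover have "r k (nxt k)" "r k' (nxt k')" using nxt k by auto
      ultimately have "r k k'" using r_sym r_trans by metis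
      then show False using nxt[of k] nxt[of k'] k eq by auto
    qed
  qed
  have fin: "finite ?C" by (auto intro: finite_subset[of _ "{i<..j}"])
  have "card ?O \<le> card ?C"
    by (rule card_inj_on_le[OF inj]) (use p fin in auto)
  moreover have "int (card ?C) = int (card {k \<in> {i<..<j}. cls k}) + of_bool (cls j)"
  proof (cases "cls j")
    case True
    then have "?C = insert j {k \<in> {i<..<j}. cls k}" using assms by auto
    moreover have "finite {k \<in> {i<..<j}. cls k}" by (auto intro: finite_subset[of _ "{i<..j}"])
    ultimately show ?thesis using True by simp
  next
    case False
    then have "?C = {k \<in> {i<..<j}. cls k}" using order_le_less by (auto simp: order_le_less)
    then show ?thesis using False by simp
  qed
  ultimately show ?thesis using H_minus_M[of i j] assms by (simp add: w.M_def mod_in_X)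
qed

lemma r_imp_E:
  assumes "r i j" "i < j" "j \<le> i + n"
  shows "w.E i j"
proof -
  have "w.M i < w.H j" using M_less_H[OF assms] assms by auto
  then have "w.M i = w.M j" using M_le_M[OF assms] w.H_le_M[of j] by simp
  then show ?thesis using M_less_H[OF assms] assms by (auto simp: w.E_def)
qed

text \<open>Induction on the distance. If the successor of \<open>i\<close> or the predecessor of
  \<open>j\<close> falls strictly inside, it shortens the interval. If both overshoot, these two
  links interleave, and \<open>r_cross\<close> puts them in one part.\<close>

lemma E_less_imp_r:
  assumes "w.E i j" "i < j"
  shows "r i j"
  using assms
proof (induction "nat (j - i)" arbitrary: i j rule: less_induct)
  case less
  have gap: "\<And>g. i < g \<Longrightarrow> g \<le> j \<Longrightarrow> w.M i < w.H g" and eq: "w.M i = w.M j"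
    using less.prems by (auto simp: w.E_def)
  have "opn i" using gap[of "i + 1"] less.prems w.H_M[of i] mod_in_Y by (auto split: if_splits)
  have "cls j" using gap[of j] less.prems eq w.M_def[of j] mod_in_X by (auto split: if_splits)
  have nx: "i < nxt i" "nxt i \<le> i + n" "r i (nxt i)" using nxt[OF \<open>opn i\<close>] by auto
  have pr: "j - n \<le> prv j" "prv j < j" "r (prv j) j" using prv[OF \<open>cls j\<close>] by auto
  have En: "w.E i (nxt i)" using r_imp_E nx by simp
  have Ep: "w.E (prv j) j" using r_imp_E pr by simp
  consider "nxt i = j" | "nxt i < j" | "prv j = i" | "i < prv j" | "j < nxt i" "prv j < i"
    by linarith
  then show ?case
  proof cases
    case 2
    have "w.E (nxt i) j" using less.prems En w.E_trans w.E_sym by blast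
    then have "r (nxt i) j" using 2 nx by (intro less.hyps) auto
    then show ?thesis using nx r_trans by blast
  next
    case 4
    have "w.E i (prv j)" using less.prems Ep w.E_trans w.E_sym by blast
    then have "r i (prv j)" using 4 pr by (intro less.hyps) auto
    then show ?thesis using pr r_trans by blast
  next
    case 5
    have "r (prv j) i"
      by (rule r_cross[of "prv j" i j "nxt i"]) (use 5 pr nx less.prems in \<open>auto intro!: less_add_period\<close>)
    then show ?thesis using pr r_trans r_sym by blast
  qed (use nx pr in auto)
qed

lemma E_imp_r: "w.E i j \<Longrightarrow> r i j"
  using E_less_imp_r[of i j] E_less_imp_r[of j i] w.E_sym[of i j] r_sym[of j i] r_refl[of i]
  by (cases i j rule: linorder_cases) blast+

text \<open>Modulo \<open>n\<close>, \<open>nxt\<close> injects \<open>Y\<close> into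
  \<open>X\<close> and \<open>prv\<close> injects \<open>X\<close> into \<open>Y\<close>. Two
  sources with equal images have translates in one part with the same neighbour, and the minimality
  of that neighbour forces the translates to coincide.\<close>

lemma card_X_eq_card_Y: "card X = card Y"
proof (rule antisym)
  have fin: "finite X" "finite Y" by (auto simp: X_def Y_def intro: finite_subset[of _ "{0..<n}"])
  have red: "i = i'" if "i + k * n = i'" "i \<in> {0..<n}" "i' \<in> {0..<n}" for i i' k
    using that by (metis atLeastLessThan_iff mod_mult_self1 mod_pos_pos_trivial)
  have "inj_on (\<lambda>i. nxt i mod n) Y"
  proof (rule inj_onI)
    fix i i' assume i: "i \<in> Y" "i' \<in> Y" and "nxt i mod n = nxt i' mod n"
    then obtain k where k: "nxt i' = nxt i + k * n"
      by (metis mod_eqE mult.commute)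
    have a: "i < nxt i" "nxt i \<le> i + n" "r i (nxt i)" "\<And>m. i < m \<Longrightarrow> m < nxt i \<Longrightarrow> \<not> r i m"
      using nxt[of i] i by (auto simp: Y_def)
    have b: "i' < nxt i'" "nxt i' \<le> i' + n" "r i' (nxt i')" "\<And>m. i' < m \<Longrightarrow> m < nxt i' \<Longrightarrow> \<not> r i' m"
      using nxt[of i'] i by (auto simp: Y_def)
    have "r (i + k * n) (nxt i')" unfolding k using a r_shift_mult by blast
    then have c: "r i' (i + k * n)" using b r_sym r_trans by blast
    then have d: "r i (i' - k * n)" using r_shift_mult[of i k "i' - k * n"] r_sym by auto
    have "i + k * n = i'"
      using b(4)[of "i + k * n"] a(4)[of "i' - k * n"] c d k a b by linarith
    then show "i = i'" using red i by (auto simp: Y_def)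
  qed
  moreover have "nxt i mod n \<in> X" if "i \<in> Y" for i
    using nxt[of i] that mod_in_X[of "nxt i"] unfolding cls_def Y_def by force
  ultimately show "card Y \<le> card X" using fin by (intro card_inj_on_le[of "\<lambda>i. nxt i mod n"]) auto
  have "inj_on (\<lambda>i. prv i mod n) X"
  proof (rule inj_onI)
    fix i i' assume i: "i \<in> X" "i' \<in> X" and "prv i mod n = prv i' mod n"
    then obtain k where k: "prv i' = prv i + k * n"
      by (metis mod_eqE mult.commute)
    have a: "i - n \<le> prv i" "prv i < i" "r (prv i) i" "\<And>m. prv i < m \<Longrightarrow> m < i \<Longrightarrow> \<not> r m i"
      using prv[of i] i by (auto simp: X_def)
    have b: "i' - n \<le> prv i'" "prv i' < i'" "r (prv i') i'" "\<And>m. prv i' < m \<Longrightarrow> m < i' \<Longrightarrow> \<not> r m i'"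
      using prv[of i'] i by (auto simp: X_def)
    have "r (prv i') (i + k * n)" unfolding k using a r_shift_mult by blast
    then have c: "r (i + k * n) i'" using b r_sym r_trans by blast
    then have d: "r (i' - k * n) i" using r_shift_mult[of i k "i' - k * n"] r_sym by auto
    have "i + k * n = i'"
      using b(4)[of "i + k * n"] a(4)[of "i' - k * n"] c d k a b by linarith
    then show "i = i'" using red i by (auto simp: X_def)
  qed
  moreover have "prv i mod n \<in> Y" if "i \<in> X" for i
    using prv[of i] that mod_in_Y[of "prv i"] unfolding opn_def X_def by force
  ultimately show "card X \<le> card Y" using fin by (intro card_inj_on_le[of "\<lambda>i. prv i mod n"]) auto
qed

sublocale w: balanced_word n X Y
  by standard (rule card_X_eq_card_Y)

text \<open>The shift by \<open>n\<close> sends the pair \<open>i\<close>, \<open>j\<close> to a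
  pair interleaved with it, so both lie in one part. At the upper extreme the shifted pair instead
  ends at \<open>i + e * n\<close>, a copy of \<open>i\<close>.\<close>

lemma r_far:
  assumes "r i j" "i + n \<le> j" "j \<le> i + e * n - n"
  shows "r i (i + n)"
proof -
  consider "j = i + n" | "j = i + e * n - n" | "i + n < j" "j < i + e * n - n"
    using assms by linarith
  then show ?thesis
  proof cases
    case 2
    then have "r (i + n) (i + e * n)" using assms r_shift[of i j] by simp
    then show ?thesis using r_period r_sym r_trans by blast
  next
    case 3
    then show ?thesis using r_cross[of i "i + n" j "j + n"] r_shift assms n_pos by simp
  qed (use assms in simp)
qed

text \<open>After moving \<open>j\<close> into the turn starting at \<open>i\<close>, it is within
  \<open>n\<close> of \<open>i\<close> or of \<open>i + N\<close>, where \<open>r_imp_E\<close>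
  applies, or far from both. In the far case \<open>r_far\<close> makes the part central, and the
  chain of steps \<open>n\<close> reduces the distance to at most \<open>n\<close>.\<close>

lemma r_iff_E: "r i j \<longleftrightarrow> (\<exists>k. w.E i (j + k * (e * n)))"
proof
  assume "\<exists>k. w.E i (j + k * (e * n))"
  then obtain k where "w.E i (j + k * (e * n))" by blast
  then have "r i (j + k * (e * n))"
    using E_imp_r[of i "j + k * (e * n)"] by blast
  then show "r i j" using r_period_mult r_sym r_trans by blast
next
  assume rij: "r i j"
  define N where "N = e * n"
  have N: "2 * n \<le> N" using two_n_le N_def by simp
  define j' where "j' = i + (j - i) mod N"
  have "0 < N" using N n_pos by linarith
  then have j': "i \<le> j'" "j' < i + N" by (auto simp: j'_def)
  have j'k: "j' = j + (- ((j - i) div N)) * N"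
    unfolding j'_def using minus_div_mult_eq_mod[of "j - i" N] by (simp add: algebra_simps)
  have rij': "r i j'" using rij r_period_mult r_trans unfolding j'k N_def by blast
  consider "j' = i" | "i < j'" "j' \<le> i + n" | "i + N - n \<le> j'" | "i + n < j'" "j' < i + N - n"
    using j' by linarith
  then have "\<exists>k. w.E i (j' + k * N)"
  proof cases
    case 1 then show ?thesis using w.E_refl by (intro exI[of _ 0]) simp
  next
    case 2 then show ?thesis using r_imp_E rij' by (intro exI[of _ 0]) simp
  next
    case 3
    have "r (j' + (-1) * (e * n)) i" using rij' r_period_mult r_sym r_trans by blast
    then have "w.E (j' - N) i" using r_imp_E[of "j' - N" i] 3 j' by (simp add: N_def)
    then show ?thesis using w.E_sym by (intro exI[of _ "-1"]) simp
  next
    case 4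
    have c: "r i (i + n)" using r_far[of i j'] rij' 4 by (simp add: N_def)
    then have Ec: "w.E i (i + n)" using r_imp_E n_pos by simp
    define t where "t = (j' - i - 1) div n"
    have "j' - t * n - i - 1 = (j' - i - 1) mod n"
      unfolding t_def using minus_div_mult_eq_mod[of "j' - i - 1" n] by simp
    then have b: "i < j' - t * n" "j' - t * n \<le> i + n"
      using pos_mod_bound[OF n_pos, of "j' - i - 1"] pos_mod_sign[OF n_pos, of "j' - i - 1"] by linarith+
    have "w.E i (i + t * n)" using Ec w.E_central by blast
    moreover have "r i (i + t * n)"
      using \<open>w.E i (i + t * n)\<close> by (rule E_imp_r)
    then have "r (i + t * n) j'" using rij' r_sym r_trans by blast
    then have "r (i + t * n) (j' - t * n + t * n)" by simp
    then have "r i (j' - t * n)" using r_shift_mult by blast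
    then have "w.E i (j' - t * n)" using r_imp_E b by simp
    then have "w.E (i + t * n) (j' - t * n + t * n)" using w.E_add_mult by blast
    ultimately have "w.E i j'" using w.E_trans by simp
    then show ?thesis by (intro exI[of _ 0]) simp
  qed
  then obtain k where "w.E i (j' + k * N)" by blast
  then have "w.E i (j + (k - (j - i) div N) * (e * n))"
    unfolding j'k N_def by (simp add: algebra_simps)
  then show "\<exists>k. w.E i (j + k * (e * n))" by blast
qed

lemma minimal_gap_iff:
  "(\<forall>i. w.H (p + 1) \<le> w.M i) \<longleftrightarrow> (\<forall>a b. a \<le> p \<longrightarrow> p < b \<longrightarrow> b \<le> a + n \<longrightarrow> \<not> r a b)"
  unfolding w.minimal_gap_iff using E_less_imp_r r_imp_E by (meson order_le_less_trans)

end

section \<open>Balanced words and noncrossing relations determine each other\<close>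

definition rel_of_word :: "int \<Rightarrow> int \<Rightarrow> int set \<Rightarrow> int set \<Rightarrow> int \<Rightarrow> int \<Rightarrow> bool" where
  "rel_of_word e n X Y i j \<longleftrightarrow> (\<exists>k. word.E n X Y i (j + k * (e * n)))"

lemma (in balanced_word) ncrel_rel_of_word:
  assumes e: "2 \<le> e"
  shows "ncrel e n (rel_of_word e n X Y)"
proof -
  define N where "N = e * n"
  define r where "r = rel_of_word e n X Y"
  have N: "2 * n \<le> N" using e n_pos by (simp add: N_def)
  have r: "r i j \<longleftrightarrow> (\<exists>k. E i (j + k * N))" for i j by (simp add: r_def rel_of_word_def N_def)
  have rI: "r i j" if "E i (j + k * N)" for i j k using that unfolding r by blast
  have rD: "\<exists>k. E i (j + k * N)" if "r i j" for i j using that unfolding r .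
  have shiftN: "E (i + k * N) (j + k * N) \<longleftrightarrow> E i j" for i j k
    using E_add_mult[of i "k * e" j] by (simp add: N_def mult.assoc)
  have E_r: "r i j" if "E i j" for i j using that rI[of i j 0] by simp
  have r_E: "r i j" if "E (i + k * N) j" for i j k
  proof -
    have "E i (j + (-k) * N)" using that shiftN[of i k "j + (-k) * N"] by simp
    then show ?thesis by (rule rI)
  qed
  have trans: "r i l" if rr: "r i j" "r j l" for i j l
  proof -
    obtain k m where k: "E i (j + k * N)" "E j (l + m * N)" using rD[OF rr(1)] rD[OF rr(2)] by blast
    then have "E (j + k * N) (l + m * N + k * N)" using shiftN by blast
    then have "E i (l + m * N + k * N)" using k(1) E_trans by blast
    then have "E i (l + (m + k) * N)" by (simp add: algebra_simps)
    then show ?thesis by (rule rI)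
  qed
  have sym: "r j i" if rij: "r i j" for i j
  proof -
    obtain k where "E i (j + k * N)" using rD[OF rij] by blast
    then show ?thesis by (rule r_E[OF E_sym])
  qed
  \<comment> \<open>Two related points of one turn are linked along one of their two arcs. A longer
    chain spans at least \<open>n\<close>, so it is central and can be translated by any multiple of
    \<open>n\<close> back to these arcs.\<close>
  have loc: "E a c \<or> E c (a + N)" if ac: "r a c" "a < c" "c < a + N" for a c
  proof -
    obtain k where k: "E a (c + k * N)" using rD[OF ac(1)] by blast
    consider "k = 0" | "k = -1" | "k \<ge> 1" | "k \<le> -2" by linarith
    then show ?thesis
    proof cases
      case 2
      then have "E (a + 1 * N) (c + k * N + 1 * N)" using k shiftN by blast
      then show ?thesis using 2 E_sym by auto
    next
      case 3
      then have "N \<le> k * N" using N n_pos mult_right_mono[of 1 k N] by simp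
      then have "E a (a + n)" using E_far[OF k] ac N n_pos by linarith
      then have "E a (a + (- k * e) * n)" using E_central by blast
      then have "E (a + (- k * e) * n) (c + k * N)" using k E_sym E_trans by blast
      then have "E (a + (- k) * N) (c + (2 * k) * N + (- k) * N)" by (simp add: N_def algebra_simps)
      then have 1: "E a (c + (2 * k) * N)" using shiftN by blast
      have "E a (a + (k * e) * n)" using \<open>E a (a + n)\<close> E_central by blast
      then have "E a (a + k * N)" by (simp add: N_def algebra_simps)
      then have "E (a + k * N) (c + k * N)" using k E_sym E_trans by blast
      then show ?thesis using shiftN by blast
    next
      case 4
      then have "k * N \<le> (-2) * N" using N n_pos by (intro mult_right_mono) auto
      then have "c + k * N + n \<le> a" using ac N n_pos by linarith
      then have "E (c + k * N) (c + k * N + n)" using E_far[OF E_sym[OF k]] by simp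
      then have "E (c + k * N) (c + k * N + (- k * e) * n)" using E_central by blast
      then have "E (c + k * N) c" by (simp add: N_def algebra_simps)
      then show ?thesis using k E_trans by blast
    qed (use k in simp)
  qed
  have "ncrel e n r"
  proof
    show "r i i" for i using E_r E_refl by blast
    show "r i (i + e * n)" for i
      unfolding r by (rule exI[of _ "-1"]) (simp add: N_def E_refl)
    show "r (i + n) (j + n)" if rij: "r i j" for i j
    proof -
      obtain k where "E i (j + k * N)" using rD[OF rij] by blast
      then have "E (i + 1 * n) (j + k * N + 1 * n)" using E_add_mult by blast
      then have "E (i + n) (j + n + k * N)" by (simp add: algebra_simps)
      then show ?thesis by (rule rI)
    qed
    fix a b c d assume o: "a < b" "b < c" "c < d" "d < a + e * n" and rr: "r a c" "r b d"
    have "E a c \<or> E c (a + N)" "E b d \<or> E d (b + N)"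
      using loc[of a c] loc[of b d] o rr by (auto simp: N_def)
    \<comment> \<open>Whichever arcs carry the two links, suitable translates by full turns still
      interleave on the line, so \<open>E_cross\<close> joins them.\<close>
    then consider "E a c" "E b d" | "E a c" "E d (b + N)" | "E c (a + N)" "E b d" | "E c (a + N)" "E d (b + N)"
      by blast
    then show "r a b"
    proof cases
      case 1 then show ?thesis using E_cross[of a b c d] o E_r by blast
    next
      case 2
      then have "E (d + (-1) * N) b" using shiftN[of d "-1" "b + N"] by simp
      then have "E (d + (-1) * N) a"
        using E_cross[of "d + (-1) * N" a b c] o 2 by (simp add: N_def)
      then have "E a b" using \<open>E (d + (-1) * N) b\<close> E_sym E_trans by blast
      then show ?thesis by (rule E_r)
    next
      case 3
      then have "E b c" using E_cross[of b c d "a + N"] o by (simp add: N_def)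
      then have "E b (a + N)" using 3 E_trans by blast
      then have "E b (a + 1 * N)" by simp
      then have "r b a" by (rule rI)
      then show ?thesis by (rule sym)
    next
      case 4
      then have "E c d" using E_cross[of c d "a + N" "b + N"] o by (simp add: N_def)
      then have "E (a + N) (b + N)" using 4 E_sym E_trans by blast
      then have "E (a + 1 * N) (b + 1 * N)" by simp
      then have "E a b" using shiftN by blast
      then show ?thesis by (rule E_r)
    qed
  next
    show "r i j \<Longrightarrow> r j i" "r i j \<Longrightarrow> r j k \<Longrightarrow> r i k" for i j k by (fact sym, fact trans)
  qed (fact e n_pos)+
  then show ?thesis by (simp add: r_def)
qed

lemma (in balanced_word) word_rel_of_word:
  assumes e: "2 \<le> e"
  shows "ncrel.X n (rel_of_word e n X Y) = X" "ncrel.Y n (rel_of_word e n X Y) = Y"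
proof -
  define N where "N = e * n"
  interpret R: ncrel e n "rel_of_word e n X Y" by (rule ncrel_rel_of_word[OF e])
  have N: "2 * n \<le> N" using R.two_n_le by (simp add: N_def)
  have rE: "rel_of_word e n X Y i j" if "E i j" for i j
    unfolding rel_of_word_def using that by (intro exI[of _ 0]) simp
  \<comment> \<open>A link that uses a nonzero number of turns has length at least \<open>n\<close>
    because \<open>2 * n \<le> N\<close>. It is then central, and arcs of length \<open>n\<close>
    start at both ends, which still witness the brackets.\<close>
  have arc: "E i j \<or> E i (i + n) \<and> E j (j + n) \<and> i \<noteq> j"
    if rij: "rel_of_word e n X Y i j" "i < j" "j \<le> i + n" for i j
  proof -
    obtain k where k: "E i (j + k * N)" using rij by (auto simp: rel_of_word_def N_def)
    have far: "E i (i + n)" if "\<bar>l - i\<bar> \<ge> n" "E i l" for i l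
    proof (cases "i + n \<le> l")
      case False
      then have "E l (l + n)" using E_far[OF E_sym[OF \<open>E i l\<close>]] that by linarith
      moreover have "E (l + n) (i + n)" using E_sym[OF \<open>E i l\<close>] E_add_mult[of l 1 i] by simp
      ultimately show ?thesis using \<open>E i l\<close> E_trans by blast
    qed (use that E_far in blast)
    have "\<bar>j + k * N - i\<bar> \<ge> n" if k0: "k \<noteq> 0"
    proof -
      consider "k \<ge> 1" | "k \<le> -1" using k0 by linarith
      then show ?thesis
      proof cases
        case 1
        then have "N \<le> k * N" using N n_pos mult_right_mono[of 1 k N] by simp
        then show ?thesis using rij N n_pos by linarith
      next
        case 2
        then have "k * N \<le> (-1) * N" using N n_pos by (intro mult_right_mono) auto
        then show ?thesis using rij N n_pos by linarith
      qed
    qed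
    then consider "k = 0" | "E i (i + n)" "E (j + k * N) (j + k * N + n)"
      using far[OF _ k] far[OF _ E_sym[OF k]] by (metis abs_minus_commute)
    then show ?thesis
    proof cases
      case 2
      have "E (j + (k * e) * n) (j + n + (k * e) * n)" using 2(2) by (simp add: N_def algebra_simps)
      then have "E j (j + n)" using E_add_mult by blast
      then show ?thesis using 2 rij by blast
    qed (use k in simp)
  qed
  have o: "R.opn i \<longleftrightarrow> i mod n \<in> Y" for i
  proof
    assume "R.opn i"
    then obtain j where "i < j" "j \<le> i + n" "rel_of_word e n X Y i j" by (auto simp: R.opn_def)
    then show "i mod n \<in> Y" using arc arc_imp_open n_pos by (metis less_add_same_cancel1)
  next
    assume "i mod n \<in> Y"
    then show "R.opn i" using open_imp_arc rE unfolding R.opn_def by blast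
  qed
  have c: "R.cls i \<longleftrightarrow> i mod n \<in> X" for i
  proof
    assume "R.cls i"
    then obtain j where j: "i - n \<le> j" "j < i" "rel_of_word e n X Y j i" by (auto simp: R.cls_def)
    then consider "E j i" | "E i (i + n)" using arc[of j i] by force
    then show "i mod n \<in> X"
    proof cases
      case 2
      then have "(i + n) mod n \<in> X" using arc_imp_close n_pos by (metis less_add_same_cancel1)
      then show ?thesis by simp
    qed (use j arc_imp_close in blast)
  next
    assume "i mod n \<in> X"
    then show "R.cls i" using close_imp_arc rE unfolding R.cls_def by blast
  qed
  show "R.X = X" using X_sub by (auto simp: R.X_def c)
  show "R.Y = Y" using Y_sub by (auto simp: R.Y_def o)
qed

definition balanced_words :: "int \<Rightarrow> (int set \<times> int set) set" where
  "balanced_words n = {(X, Y). X \<subseteq> {0..<n} \<and> Y \<subseteq> {0..<n} \<and> card X = card Y}"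

definition word_of_rel :: "int \<Rightarrow> (int \<Rightarrow> int \<Rightarrow> bool) \<Rightarrow> int set \<times> int set" where
  "word_of_rel n r = (ncrel.X n r, ncrel.Y n r)"

lemma bij_betw_word_of_rel:
  assumes "2 \<le> e" "0 < n"
  shows "bij_betw (word_of_rel n) {r. ncrel e n r} (balanced_words n)"
proof (rule bij_betw_byWitness[where f' = "\<lambda>(A, B). rel_of_word e n A B"])
  show "\<forall>r\<in>{r. ncrel e n r}. (case word_of_rel n r of (A, B) \<Rightarrow> rel_of_word e n A B) = r"
  proof
    fix r assume "r \<in> {r. ncrel e n r}"
    then interpret ncrel e n r by simp
    show "(case word_of_rel n r of (A, B) \<Rightarrow> rel_of_word e n A B) = r"
      by (intro ext) (simp add: word_of_rel_def rel_of_word_def r_iff_E)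
  qed
  have bw: "balanced_word n A B" if "(A, B) \<in> balanced_words n" for A B
    using that assms by unfold_locales (auto simp: balanced_words_def)
  show "\<forall>w\<in>balanced_words n. word_of_rel n (case w of (A, B) \<Rightarrow> rel_of_word e n A B) = w"
    using balanced_word.word_rel_of_word[OF bw] assms by (auto simp: word_of_rel_def)
  show "word_of_rel n ` {r. ncrel e n r} \<subseteq> balanced_words n"
  proof safe
    fix r A B assume "ncrel e n r" and XY: "(A, B) = word_of_rel n r"
    then interpret ncrel e n r by simp
    show "(A, B) \<in> balanced_words n" unfolding XY
      using w.X_sub w.Y_sub card_X_eq_card_Y by (simp add: word_of_rel_def balanced_words_def)
  qed
  show "(\<lambda>(A, B). rel_of_word e n A B) ` balanced_words n \<subseteq> {r. ncrel e n r}"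
    using balanced_word.ncrel_rel_of_word[OF bw] assms by auto
qed

subsection \<open>The cycle lemma\<close>

definition excess_words :: "int \<Rightarrow> (int set \<times> int set) set" where
  "excess_words n = {(X, Y). X \<subseteq> {0..<n} \<and> Y \<subseteq> {0..<n} \<and> card Y = card X + 1}"

text \<open>By \<open>minimal_gap_iff\<close>, for a balanced word these are the gaps, one for each
  class modulo \<open>n\<close>, that no link of length at most \<open>n\<close> passes
  over.\<close>

definition minimal_gaps :: "int \<Rightarrow> int set \<times> int set \<Rightarrow> int set" where
  "minimal_gaps n = (\<lambda>(X, Y). {p \<in> {0..<n}. \<forall>i. word.H n X Y (p + 1) \<le> word.M n X Y i})"

context balanced_word
begin

lemma representative:
  obtains k where "p < i + k * n" "i + k * n \<le> p + n"
proof -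
  define k where "k = - ((i - p - 1) div n)"
  have "i + k * n - p - 1 = (i - p - 1) mod n"
    unfolding k_def using minus_div_mult_eq_mod[of "i - p - 1" n] by simp
  then have "p < i + k * n" "i + k * n \<le> p + n"
    using pos_mod_bound[OF n_pos, of "i - p - 1"] pos_mod_sign[OF n_pos, of "i - p - 1"] by linarith+
  then show ?thesis by (rule that)
qed

text \<open>Inserting \<open>p\<close> leaves the steps strictly between \<open>p\<close> and
  \<open>p + n\<close> unchanged and puts the new level after \<open>p\<close> at one more than the
  new \<open>M p\<close>. So both conditions agree on the period after \<open>p\<close>. Later the
  old level repeats while the new one gains one per period, so nothing is lost.\<close>

lemma minimal_gap_iff_last_minimum:
  assumes p: "p \<in> {0..<n}" "p \<notin> Y"
  shows "(\<forall>i. H (p + 1) \<le> M i) \<longleftrightarrow> (\<forall>i>p. word.M n X (insert p Y) p < word.M n X (insert p Y) i)"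
proof -
  interpret w': word n X "insert p Y"
    using p X_sub Y_sub n_pos by unfold_locales auto
  have cY: "card (insert p Y) = card X + 1"
    using p balanced finite_subset[OF Y_sub] by simp
  have pn: "p mod n = p" using p by simp
  have start: "w'.H (p + 1) = w'.M p + 1" by (simp add: w'.H_M pn)
  have same: "w'.M i - w'.H (p + 1) = M i - H (p + 1)" if i: "p < i" "i \<le> p + n" for i
  proof -
    have "w'.step k = step k" if "k \<in> {p+1..<i}" for k
    proof -
      have "k mod n \<noteq> p"
      proof
        assume "k mod n = p"
        then have "k = p + (k div n) * n" using div_mult_mod_eq[of k n] by simp
        moreover have "0 < k - p" "k - p < n" using that i by auto
        ultimately have t: "0 < (k div n) * n" "(k div n) * n < n" by linarith+
        then have "1 * n \<le> (k div n) * n"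
          using n_pos by (intro mult_right_mono) (auto simp: zero_less_mult_iff)
        then show False using t(2) by (metis mult_1 not_le)
      qed
      then show ?thesis by (simp add: w'.step_def step_def)
    qed
    then have "sum w'.step {p+1..<i} = sum step {p+1..<i}" by (intro sum.cong) auto
    then have "w'.H i - w'.H (p + 1) = H i - H (p + 1)"
      using i w'.H_diff[of "p+1" i] H_diff[of "p+1" i] by simp
    then show ?thesis by (simp add: M_def w'.M_def)
  qed
  have w'_mult: "w'.M (i + k * n) = w'.M i + k" for i k by (simp add: w'.M_add_mult cY)
  show ?thesis
  proof
    assume L: "\<forall>i. H (p + 1) \<le> M i"
    show "\<forall>i>p. w'.M p < w'.M i"
    proof (intro allI impI)
      fix i assume "p < i"
      obtain k where k: "p < i + k * n" "i + k * n \<le> p + n" by (rule representative)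
      have "k \<le> 0"
      proof (rule ccontr)
        assume "\<not> k \<le> 0"
        then have "1 * n \<le> k * n" using n_pos by (intro mult_right_mono) auto
        then have "n \<le> k * n" by (simp only: mult_1)
        then show False using k \<open>p < i\<close> by linarith
      qed
      moreover have "w'.M p < w'.M (i + k * n)"
        using same[OF k] start L[rule_format, of "i + k * n"] by linarith
      ultimately show "w'.M p < w'.M i" using w'_mult[of i k] by simp
    qed
  next
    assume R: "\<forall>i>p. w'.M p < w'.M i"
    show "\<forall>i. H (p + 1) \<le> M i"
    proof
      fix i
      obtain k where k: "p < i + k * n" "i + k * n \<le> p + n" by (rule representative)
      then show "H (p + 1) \<le> M i"
        using same[OF k] start R[rule_format, of "i + k * n"] M_periodic[of i k] by linarith
    qed
  qed
qed

end

text \<open>The cycle lemma. \<open>M\<close> gains one per period, so the last minimum over one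
  period is never reached again. If two positions \<open>p < q\<close> of a period had this
  property, then \<open>M p < M q < M (p + n) = M p + 1\<close>, which no integer allows.\<close>

lemma (in word) last_minimum:
  assumes excess: "card Y = card X + 1"
  shows "\<exists>p\<in>Y. \<forall>i>p. M p < M i"
    and "p \<in> {0..<n} \<Longrightarrow> q \<in> {0..<n} \<Longrightarrow> \<forall>i>p. M p < M i \<Longrightarrow> \<forall>i>q. M q < M i \<Longrightarrow> p = q"
proof -
  have mult: "M (i + k * n) = M i + k" for i k by (simp add: M_add_mult excess)
  define m where "m = Min (M ` {0..<n})"
  define A where "A = {k \<in> {0..<n}. M k = m}"
  have ne: "M ` {0..<n} \<noteq> {}" using n_pos by auto
  have m_le: "m \<le> M k" if "k \<in> {0..<n}" for k using that by (simp add: m_def)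
  have "m \<in> M ` {0..<n}" unfolding m_def using ne by (intro Min_in) auto
  then have "A \<noteq> {}" by (auto simp: A_def)
  moreover have "finite A" by (rule finite_subset[of _ "{0..<n}"]) (auto simp: A_def)
  ultimately have *: "Max A \<in> A" "\<And>k. k \<in> A \<Longrightarrow> k \<le> Max A" by (auto intro: Max_in)
  define p where "p = Max A"
  have p: "p \<in> {0..<n}" "M p = m" using *(1) by (auto simp: A_def p_def)
  have above: "M p < M i" if "p < i" for i
  proof -
    define t where "t = i div n"
    define i0 where "i0 = i mod n"
    have i0: "i0 \<in> {0..<n}" "i = i0 + t * n" using n_pos by (auto simp: i0_def t_def)
    then have Mi: "M i = M i0 + t" using mult by simp
    have "t \<ge> 0" using that p n_pos by (simp add: t_def pos_imp_zdiv_nonneg_iff)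
    show ?thesis
    proof (cases "t = 0")
      case True
      then have "i0 \<notin> A" using *(2)[of i0] that i0 p_def by auto
      then show ?thesis using m_le[of i0] i0 p Mi True by (simp add: A_def)
    next
      case False
      then show ?thesis using m_le[of i0] i0 p Mi \<open>t \<ge> 0\<close> by simp
    qed
  qed
  \<comment> \<open>The level can rise above \<open>M p\<close> by position \<open>p + 1\<close>
    only through an opening bracket at \<open>p\<close>.\<close>
  have "p mod n \<in> Y" 
    using above[of "p + 1"] H_M[of p] M_le_H[of "p + 1"] by (cases "p mod n \<in> Y") auto
  then show "\<exists>p\<in>Y. \<forall>i>p. M p < M i" using p above by (intro bexI[of _ p]) auto
  have no: False if "p \<in> {0..<n}" "q \<in> {0..<n}" "p < q" "\<forall>i>p. M p < M i" "\<forall>i>q. M q < M i" for p q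
  proof -
    have "M p < M q" using that by simp
    moreover have "M q < M (p + 1 * n)" using that by (intro that(5)[rule_format]) auto
    ultimately show False using mult[of p 1] by simp
  qed
  show "p \<in> {0..<n} \<Longrightarrow> q \<in> {0..<n} \<Longrightarrow> \<forall>i>p. M p < M i \<Longrightarrow> \<forall>i>q. M q < M i \<Longrightarrow> p = q" for p q
    using no[of p q] no[of q p] by (cases p q rule: linorder_cases) auto
qed

lemma bij_betw_minimal_gaps:
  assumes n: "0 < n"
  shows "bij_betw (\<lambda>((X, Y), p). (X, insert p Y))
    (SIGMA w:balanced_words n. minimal_gaps n w) (excess_words n)"
proof -
  have bw: "balanced_word n X Y" if "(X, Y) \<in> balanced_words n" for X Y
    using that n by unfold_locales (auto simp: balanced_words_def)
  have gap: "p \<in> {0..<n} \<and> p \<notin> Y \<and> (X, insert p Y) \<in> excess_words n \<and>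
      (\<forall>i>p. word.M n X (insert p Y) p < word.M n X (insert p Y) i)"
    if w: "(X, Y) \<in> balanced_words n" and "p \<in> minimal_gaps n (X, Y)" for X Y p
  proof -
    interpret balanced_word n X Y by (rule bw[OF w])
    have p: "p \<in> {0..<n}" "\<forall>i. H (p + 1) \<le> M i" using that by (auto simp: minimal_gaps_def)
    have "H (p + 1) \<le> M p" using p by blast
    then have "p \<notin> Y" using p H_M[of p] by auto
    moreover have "(X, insert p Y) \<in> excess_words n"
      using p \<open>p \<notin> Y\<close> balanced X_sub Y_sub finite_subset[OF Y_sub] by (simp add: excess_words_def)
    ultimately show ?thesis using p minimal_gap_iff_last_minimum by blast
  qed
  have ew: "word n X Y" "card Y = card X + 1" if "(X, Y) \<in> excess_words n" for X Y
    using that n by (auto simp: excess_words_def intro: word.intro)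
  show ?thesis unfolding bij_betw_def
  proof
    show "inj_on (\<lambda>((X, Y), p). (X, insert p Y)) (SIGMA w:balanced_words n. minimal_gaps n w)"
    proof (rule inj_onI, clarsimp)
      fix X Y Y' p p'
      assume w: "(X, Y) \<in> balanced_words n" "p \<in> minimal_gaps n (X, Y)"
        "(X, Y') \<in> balanced_words n" "p' \<in> minimal_gaps n (X, Y')" and eq: "insert p Y = insert p' Y'"
      have "p = p'"
        using gap[OF w(1,2)] gap[OF w(3,4)] ew[of X "insert p Y"] eq
          word.last_minimum(2)[of n X "insert p Y" p p'] by auto
      moreover have "p \<notin> Y" "p' \<notin> Y'" using gap[OF w(1,2)] gap[OF w(3,4)] by auto
      ultimately show "Y = Y' \<and> p = p'" using eq by (simp add: insert_ident)
    qed
    show "(\<lambda>((X, Y), p). (X, insert p Y)) ` (SIGMA w:balanced_words n. minimal_gaps n w) = excess_words n"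
    proof (intro equalityI subsetI)
      fix z assume "z \<in> excess_words n"
      then obtain X Y' where z: "z = (X, Y')" "(X, Y') \<in> excess_words n" by (cases z) auto
      interpret w': word n X Y' using ew z by blast
      obtain p where p: "p \<in> Y'" "\<forall>i>p. w'.M p < w'.M i" using w'.last_minimum(1) ew z by blast
      define Y where "Y = Y' - {p}"
      have Y: "p \<notin> Y" "Y' = insert p Y" using p by (auto simp: Y_def)
      have bal: "(X, Y) \<in> balanced_words n"
        using z p finite_subset[OF w'.Y_sub] by (auto simp: Y_def balanced_words_def excess_words_def)
      have p0: "p \<in> {0..<n}" using p w'.Y_sub by auto
      then have "p \<in> minimal_gaps n (X, Y)"
        using balanced_word.minimal_gap_iff_last_minimum[OF bw[OF bal] p0 Y(1)] p Y(2)
        by (simp add: minimal_gaps_def)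
      then show "z \<in> (\<lambda>((X, Y), p). (X, insert p Y)) ` (SIGMA w:balanced_words n. minimal_gaps n w)"
        using bal z Y(2) by force
    qed (use gap in force)
  qed
qed

section \<open>Counting balanced words and words of excess one\<close>

lemma card_pairs_same:
  "card {(X, Y). X \<subseteq> {0..<int n} \<and> Y \<subseteq> {0..<int n} \<and> card Y = card X + d} = (\<Sum>k\<le>n. (n choose k) * (n choose (k + d)))"
proof -
  let ?S = "\<lambda>k. {X. X \<subseteq> {0..<int n} \<and> card X = k}"
  have fin: "finite (?S k)" for k by (rule finite_subset[of _ "Pow {0..<int n}"]) auto
  have c: "card (?S k) = n choose k" for k using n_subsets[of "{0..<int n}" k] by simp
  have le: "card X \<le> n" if "X \<subseteq> {0..<int n}" for X using card_mono[OF _ that] by simp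
  have "{(X, Y). X \<subseteq> {0..<int n} \<and> Y \<subseteq> {0..<int n} \<and> card Y = card X + d} = (\<Union>k\<le>n. ?S k \<times> ?S (k + d))"
    using le by auto
  also have "card \<dots> = (\<Sum>k\<le>n. card (?S k \<times> ?S (k + d)))"
    by (rule card_UN_disjoint) (use fin in auto)
  finally show ?thesis by (simp add: card_cartesian_product c)
qed

lemma card_balanced_words: "card (balanced_words (int n)) = (2 * n) choose n"
proof -
  have "balanced_words (int n) = {(X, Y). X \<subseteq> {0..<int n} \<and> Y \<subseteq> {0..<int n} \<and> card Y = card X + 0}"
    by (auto simp: balanced_words_def)
  then show ?thesis using card_pairs_same[of n 0] choose_square_sum[of n] by (simp add: power2_eq_square)
qed

lemma card_excess_words: 
  assumes "0 < n"
  shows "card (excess_words (int n)) = (2 * n) choose (n - 1)"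
proof -
  have "card (excess_words (int n)) = (\<Sum>k\<le>n. (n choose k) * (n choose (k + 1)))"
    unfolding excess_words_def by (rule card_pairs_same)
  \<comment> \<open>The term for \<open>k = n\<close> vanishes; dropping it gives the range that
    Vandermonde needs and makes \<open>k + 1 \<le> n\<close> available for the symmetry of
    binomials.\<close>
  also have "\<dots> = (\<Sum>k\<le>n - 1. (n choose k) * (n choose (k + 1)))"
    by (rule sum.mono_neutral_right) (auto simp: not_le)
  also have "\<dots> = (\<Sum>k\<le>n - 1. (n choose k) * (n choose (n - 1 - k)))"
  proof (rule sum.cong)
    fix k assume "k \<in> {..n - 1}"
    then have "k + 1 \<le> n" using assms by auto
    then show "(n choose k) * (n choose (k + 1)) = (n choose k) * (n choose (n - 1 - k))"
      using binomial_symmetric[of "k + 1" n] by simp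
  qed simp
  also have "\<dots> = (n + n) choose (n - 1)" by (rule vandermonde)
  finally show ?thesis by (simp add: mult_2)
qed

subsection \<open>Convex hulls of sets of roots of unity\<close>

lemma convex_combination_mem_hull:
  fixes x y :: complex
  assumes "0 \<le> s" "0 \<le> t" "0 < s + t"
  shows "(complex_of_real s * x + complex_of_real t * y) / complex_of_real (s + t) \<in> convex hull {x, y}"
proof -
  have "(s / (s + t)) *\<^sub>R x + (t / (s + t)) *\<^sub>R y \<in> convex hull {x, y}"
    unfolding convex_hull_2 using assms
    by (intro CollectI exI[of _ "s / (s + t)"] exI[of _ "t / (s + t)"]) (simp flip: add_divide_distrib)
  also have "(s / (s + t)) *\<^sub>R x + (t / (s + t)) *\<^sub>R y
      = (complex_of_real s * x + complex_of_real t * y) / complex_of_real (s + t)"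
    by (simp add: scaleR_conv_of_real add_divide_distrib)
  finally show ?thesis .
qed

text \<open>Twice the signed area of the triangle on the unit circle with the given arguments.\<close>

definition area :: "real \<Rightarrow> real \<Rightarrow> real \<Rightarrow> real" where
  "area x y z = sin (y - x) + sin (z - y) + sin (x - z)"

text \<open>In the half angles \<open>A\<close> and \<open>B\<close> the sum of sines factors as
  \<open>4 * (sin A * sin B * sin (A + B))\<close>, and all three angles lie strictly between 0 and
  \<open>pi\<close>.\<close>

lemma area_pos:
  assumes "x < y" "y < z" "z < x + 2 * pi"
  shows "0 < area x y z"
proof -
  define A B where "A = (y - x) / 2" and "B = (z - y) / 2"
  have yx: "y - x = 2 * A" "z - y = 2 * B" "x - z = - (2 * (A + B))"
    by (simp_all add: A_def B_def field_simps)
  have "area x y z = 2 * (sin A * cos A) + 2 * (sin B * cos B) - 2 * (sin (A + B) * cos (A + B))"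
    unfolding area_def yx sin_minus sin_double by simp
  also have "\<dots> = 2 * (sin A * cos A * (1 - (cos B)\<^sup>2 + (sin B)\<^sup>2) + sin B * cos B * (1 - (cos A)\<^sup>2 + (sin A)\<^sup>2))"
    unfolding sin_add cos_add by (simp add: algebra_simps power2_eq_square)
  also have "\<dots> = 4 * (sin A * sin B * sin (A + B))"
  proof -
    have sq: "1 - (cos B)\<^sup>2 = (sin B)\<^sup>2" "1 - (cos A)\<^sup>2 = (sin A)\<^sup>2"
      using sin_cos_squared_add[of A] sin_cos_squared_add[of B] by linarith+
    show ?thesis unfolding sq sin_add by (simp add: algebra_simps power2_eq_square)
  qed
  finally have "area x y z = 4 * (sin A * sin B * sin (A + B))" .
  moreover have "0 < sin A" "0 < sin B" "0 < sin (A + B)"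
    using assms by (auto simp: A_def B_def field_simps intro!: sin_gt_zero)
  ultimately show ?thesis by simp
qed

text \<open>The intersection point of the diagonals of a quadrilateral has the areas of the triangles as
  barycentric coordinates.\<close>

lemma chords_intersect:
  assumes "x < y" "y < z" "z < w" "w < x + 2 * pi"
  shows "convex hull {cis x, cis z} \<inter> convex hull {cis y, cis w} \<noteq> {}"
proof -
  define a b c d where "a = area y z w" and "b = area x z w" and "c = area x y w" and "d = area x y z"
  have pos: "0 < a" "0 < b" "0 < c" "0 < d"
    using assms by (auto simp: a_def b_def c_def d_def intro!: area_pos)
  have "a + c = b + d" unfolding a_def b_def c_def d_def area_def sin_diff by simp
  moreover have "complex_of_real a * cis x + complex_of_real c * cis z
      = complex_of_real b * cis y + complex_of_real d * cis w"
    unfolding a_def b_def c_def d_def area_def sin_diff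
    by (simp add: complex_eq_iff algebra_simps)
  ultimately have "(complex_of_real a * cis x + complex_of_real c * cis z) / complex_of_real (a + c)
      = (complex_of_real b * cis y + complex_of_real d * cis w) / complex_of_real (b + d)" by simp
  then show ?thesis
    using convex_combination_mem_hull[of a c "cis x" "cis z"]
      convex_combination_mem_hull[of b d "cis y" "cis w"] pos by (auto simp del: of_real_add)
qed

text \<open>The addition formulas give \<open>u * cis y = s * cis x + t * cis z\<close>. Positivity
  of the triangle's area says \<open>u < s + t\<close>, so the origin receives the positive weight
  \<open>s + t - u\<close>.\<close>

lemma radius_intersects_chord:
  assumes "x < y" "y < z" "z < x + pi"
  shows "convex hull {0, cis y} \<inter> convex hull {cis x, cis z} \<noteq> {}"
proof -
  define s t u where "s = sin (z - y)" and "t = sin (y - x)" and "u = sin (z - x)"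
  have pos: "0 < s" "0 < t" "0 < u" using assms by (auto simp: s_def t_def u_def intro!: sin_gt_zero)
  have "0 < area x y z" using assms by (intro area_pos) auto
  then have less: "u < s + t" unfolding area_def s_def t_def u_def
    using sin_minus[of "z - x"] by simp
  have "complex_of_real u * cis y = complex_of_real s * cis x + complex_of_real t * cis z"
    unfolding s_def t_def u_def sin_diff complex_eq_iff by (simp add: algebra_simps)
  then have "(complex_of_real (s + t - u) * 0 + complex_of_real u * cis y) / complex_of_real (s + t - u + u)
      = (complex_of_real s * cis x + complex_of_real t * cis z) / complex_of_real (s + t)" by simp
  then show ?thesis
    using convex_combination_mem_hull[of "s + t - u" u 0 "cis y"]
      convex_combination_mem_hull[of s t "cis x" "cis z"] pos less
    by (auto simp del: of_real_add of_real_diff)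
qed

text \<open>One half-space is closed because the separating line used below passes through the end
  points of the arc carrying \<open>Q\<close>.\<close>

lemma hulls_disjoint_if_halfspace:
  fixes u :: complex
  assumes "P \<subseteq> {z. inner u z < t}" "Q \<subseteq> {z. t \<le> inner u z}"
  shows "convex hull P \<inter> convex hull Q = {}"
proof -
  have "convex hull P \<subseteq> {z. inner u z < t}"
    using assms(1) by (rule hull_minimal) (rule convex_halfspace_lt)
  moreover have "convex hull Q \<subseteq> {z. t \<le> inner u z}"
    using assms(2) by (rule hull_minimal) (rule convex_halfspace_ge)
  ultimately show ?thesis by (force dest: subsetD)
qed

section \<open>Roots of unity numbered by the integers, and lines separating arcs\<close>

locale roots =
  fixes N :: int
  assumes N_pos: "0 < N"
begin

definition W :: "int \<Rightarrow> complex" where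
  "W k = cis (2 * pi * (real_of_int k / real_of_int N))"

lemma W_add: "W (i + j) = W i * W j"
  by (simp add: W_def cis_mult add_divide_distrib distrib_left)

lemma W_eq_iff: "W i = W j \<longleftrightarrow> (\<exists>k. j = i + k * N)"
proof -
  have "W i = W j \<longleftrightarrow> (\<exists>k::int. 2 * pi * (real_of_int j / N) = 2 * pi * (real_of_int i / N) + 2 * pi * k)"
    unfolding W_def sin_cos_eq_iff[symmetric] by (auto simp: complex_eq_iff)
  also have "\<dots> \<longleftrightarrow> (\<exists>k::int. real_of_int j / N = real_of_int i / N + k)"
  proof -
    have "2 * pi * (real_of_int j / N) = 2 * pi * (real_of_int i / N) + 2 * pi * k \<longleftrightarrow>
      real_of_int j / N = real_of_int i / N + k" for k :: int
      by (metis distrib_left mult_cancel_left pi_neq_zero zero_neq_numeral mult_eq_0_iff)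
    then show ?thesis by simp
  qed
  also have "\<dots> \<longleftrightarrow> (\<exists>k::int. real_of_int j = real_of_int (i + k * N))"
  proof -
    have "real_of_int j / N = real_of_int i / N + k \<longleftrightarrow> real_of_int j = real_of_int (i + k * N)" for k :: int
      using N_pos by (auto simp: field_simps)
    then show ?thesis by simp
  qed
  finally show ?thesis by (simp only: of_int_eq_iff)
qed

lemma W_period: "W (i + k * N) = W i"
  using W_eq_iff by metis

lemma W_range: "range W = {z. z ^ nat N = 1}"
proof -
  have "(\<lambda>k. cis (2 * pi * real k / real (nat N))) ` {..<nat N} = {z. z ^ nat N = 1}"
    using Complex.bij_betw_roots_unity[of "nat N"] N_pos by (simp add: bij_betw_def)
  moreover have "(\<lambda>k. cis (2 * pi * real k / real (nat N))) ` {..<nat N} = W ` {0..<N}"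
  proof -
    have "int ` {..<nat N} = {0..<N}"
      using N_pos image_int_atLeastLessThan[of 0 "nat N"] by (simp add: atLeast0LessThan)
    then show ?thesis using N_pos by (simp flip: \<open>int ` _ = _\<close> add: image_image W_def)
  qed
  moreover have "range W = W ` {0..<N}"
  proof -
    have "W i \<in> W ` {0..<N}" for i
      using W_period[of "i mod N" "i div N"] N_pos by (auto intro!: image_eqI[of _ _ "i mod N"])
    then show ?thesis by auto
  qed
  ultimately show ?thesis by simp
qed

lemma translate:
  obtains k where "a \<le> i + k * N" "i + k * N < a + N"
proof -
  define k where "k = - ((i - a) div N)"
  have "i + k * N - a = (i - a) mod N"
    unfolding k_def using minus_div_mult_eq_mod[of "i - a" N] by simp
  then have "a \<le> i + k * N" "i + k * N < a + N"
    using pos_mod_bound[OF N_pos, of "i - a"] pos_mod_sign[OF N_pos, of "i - a"] by linarith+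
  then show ?thesis by (rule that)
qed

lemma W_chords_intersect:
  assumes "a < b" "b < c" "c < d" "d < a + N"
  shows "convex hull {W a, W c} \<inter> convex hull {W b, W d} \<noteq> {}"
proof -
  have "2 * pi * (real_of_int d / N) < 2 * pi * (real_of_int a / N) + 2 * pi"
  proof -
    have "real_of_int d / N < real_of_int a / N + 1" using assms N_pos by (simp add: field_simps)
    then have "2 * pi * (real_of_int d / N) < 2 * pi * (real_of_int a / N + 1)"
      by (intro mult_strict_left_mono) auto
    then show ?thesis by (simp add: distrib_left)
  qed
  moreover have "2 * pi * (real_of_int i / N) < 2 * pi * (real_of_int j / N)" if "i < j" for i j
    using that N_pos by (simp add: divide_strict_right_mono)
  ultimately show ?thesis unfolding W_def using assms by (intro chords_intersect) auto
qed

lemma W_radius_intersects_chord: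
  assumes "a < b" "b < c" "2 * (c - a) < N"
  shows "convex hull {0, W b} \<inter> convex hull {W a, W c} \<noteq> {}"
proof -
  have "2 * pi * (real_of_int c / N) < 2 * pi * (real_of_int a / N) + pi"
  proof -
    have "2 * (real_of_int c - real_of_int a) < real_of_int N" using assms(3) by (metis of_int_diff of_int_less_iff of_int_mult of_int_numeral)
    then have "2 * (real_of_int c / N) < 2 * (real_of_int a / N) + 1" using N_pos by (simp add: field_simps)
    then have "pi * (2 * (real_of_int c / N)) < pi * (2 * (real_of_int a / N) + 1)"
      by (intro mult_strict_left_mono) auto
    then show ?thesis by (simp only: distrib_left mult.assoc mult.left_commute[of 2] mult_1_right)
  qed
  moreover have "2 * pi * (real_of_int i / N) < 2 * pi * (real_of_int j / N)" if "i < j" for i j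
    using that N_pos by (simp add: divide_strict_right_mono)
  ultimately show ?thesis unfolding W_def using assms by (intro radius_intersects_chord) auto
qed

text \<open>The direction of the midpoint of an arc separates the arc from its complement.\<close>

lemma inner_midpoint:
  defines "u b c \<equiv> cis (pi * (real_of_int (b + c) / N))"
    and "h b c \<equiv> cos (pi * (real_of_int (c - b) / N))"
  shows "b \<le> k \<Longrightarrow> k \<le> c \<Longrightarrow> c < b + N \<Longrightarrow> h b c \<le> inner (u b c) (W k)"
    and "b \<le> c \<Longrightarrow> c < k \<Longrightarrow> k < b + N \<Longrightarrow> inner (u b c) (W k) < h b c"
proof -
  have inner: "inner (u b c) (W k) = cos (pi * (real_of_int (2 * k - b - c) / N))" for b c k
  proof -
    have "inner (u b c) (W k) = cos (2 * pi * (real_of_int k / N) - pi * (real_of_int (b + c) / N))"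
      unfolding u_def W_def inner_complex_def cos_diff by simp
    also have "2 * pi * (real_of_int k / N) - pi * (real_of_int (b + c) / N) = pi * (real_of_int (2 * k - b - c) / N)"
      using N_pos by (simp add: field_simps)
    finally show ?thesis .
  qed
  have le: "pi * (real_of_int i / N) \<le> pi * (real_of_int j / N)" if "i \<le> j" for i j
    using that N_pos by (intro mult_left_mono divide_right_mono) auto
  have lt: "pi * (real_of_int i / N) < pi * (real_of_int j / N)" if "i < j" for i j
    using that N_pos by (intro mult_strict_left_mono divide_strict_right_mono) auto
  have N1: "pi * (real_of_int N / N) = pi" and N0: "pi * (real_of_int 0 / N) = 0" using N_pos by auto
  show "h b c \<le> inner (u b c) (W k)" if "b \<le> k" "k \<le> c" "c < b + N"
  proof -
    have "cos (pi * (real_of_int m / N)) = cos (pi * (real_of_int \<bar>m\<bar> / N))" for m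
      by (cases "0 \<le> m") simp_all
    then have "cos (pi * (real_of_int (2 * k - b - c) / N)) = cos (pi * (real_of_int \<bar>2 * k - b - c\<bar> / N))" .
    moreover have "cos (pi * (real_of_int (c - b) / N)) \<le> cos (pi * (real_of_int \<bar>2 * k - b - c\<bar> / N))"
      using le[of 0 "\<bar>2 * k - b - c\<bar>"] le[of "\<bar>2 * k - b - c\<bar>" "c - b"] le[of "c - b" N] N1 N0 that
      by (intro cos_monotone_0_pi_le) auto
    ultimately show ?thesis by (simp add: inner h_def)
  qed
  show "inner (u b c) (W k) < h b c" if "b \<le> c" "c < k" "k < b + N"
  proof (cases "2 * k - b - c \<le> N")
    case True
    then have "cos (pi * (real_of_int (2 * k - b - c) / N)) < cos (pi * (real_of_int (c - b) / N))"
      using le[of 0 "c - b"] lt[of "c - b" "2 * k - b - c"] le[of "2 * k - b - c" N] N1 N0 that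
      by (intro cos_monotone_0_pi) auto
    then show ?thesis by (simp add: inner h_def)
  next
    case False
    \<comment> \<open>Past the antipode of the midpoint the angle exceeds \<open>pi\<close>; it is
      reflected into the range where cosine decreases.\<close>
    have "pi * (real_of_int (2 * k - b - c) / N) = - (pi * (real_of_int (2 * N - (2 * k - b - c)) / N)) + 2 * pi"
      using N_pos by (simp add: field_simps)
    then have "cos (pi * (real_of_int (2 * k - b - c) / N)) = cos (pi * (real_of_int (2 * N - (2 * k - b - c)) / N))"
      by (metis cos_minus cos_periodic)
    moreover have "cos (pi * (real_of_int (2 * N - (2 * k - b - c)) / N)) < cos (pi * (real_of_int (c - b) / N))"
      using le[of 0 "c - b"] lt[of "c - b" "2 * N - (2 * k - b - c)"] le[of "2 * N - (2 * k - b - c)" N] N1 N0 that False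
      by (intro cos_monotone_0_pi) auto
    ultimately show ?thesis by (simp add: inner h_def)
  qed
qed

lemma arcs_hulls_disjoint:
  assumes "b \<le> c" "c < b + N" "Q \<subseteq> W ` {b..c}" "P \<subseteq> W ` {c<..<b+N}"
  shows "convex hull P \<inter> convex hull Q = {}"
proof (rule hulls_disjoint_if_halfspace)
  show "P \<subseteq> {z. inner (cis (pi * (real_of_int (b + c) / N))) z < cos (pi * (real_of_int (c - b) / N))}"
    using assms(1,4) inner_midpoint(2)[of b c] by auto
  show "Q \<subseteq> {z. cos (pi * (real_of_int (c - b) / N)) \<le> inner (cis (pi * (real_of_int (b + c) / N))) z}"
    using assms(2,3) inner_midpoint(1)[of b _ c] by auto
qed

text \<open>For an arc shorter than half a turn the threshold cosine is positive, so the separating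
  line leaves 0 on the side of \<open>P\<close>.\<close>

lemma arcs_hulls_disjoint_0:
  assumes "b \<le> c" "2 * (c - b) < N" "Q \<subseteq> W ` {b..c}" "P \<subseteq> W ` {c<..<b+N}"
  shows "convex hull (insert 0 P) \<inter> convex hull Q = {}"
proof (rule hulls_disjoint_if_halfspace)
  have c: "c < b + N" using assms(1,2) N_pos by arith
  then show "Q \<subseteq> {z. cos (pi * (real_of_int (c - b) / N)) \<le> inner (cis (pi * (real_of_int (b + c) / N))) z}"
    using assms(3) inner_midpoint(1)[of b _ c] by auto
  have "2 * real_of_int (c - b) < real_of_int N" using assms(2) by (metis of_int_less_iff of_int_mult of_int_numeral)
  then have "real_of_int (c - b) / N < 1 / 2" using N_pos by (simp add: field_simps)
  then have "pi * (real_of_int (c - b) / N) < pi * (1 / 2)" by (intro mult_strict_left_mono) auto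
  moreover have "0 \<le> pi * (real_of_int (c - b) / N)" using assms N_pos by simp
  ultimately have "0 < cos (pi * (real_of_int (c - b) / N))" by (intro cos_gt_zero_pi) auto
  then show "insert 0 P \<subseteq> {z. inner (cis (pi * (real_of_int (b + c) / N))) z < cos (pi * (real_of_int (c - b) / N))}"
    using assms(1,4) inner_midpoint(2)[of b c] by auto
qed

end

subsection \<open>Partitions of roots of unity as relations on the integers\<close>

locale ncp =
  fixes e n :: nat
  assumes e_ge: "2 \<le> e" and n_ge: "1 \<le> n"
begin

abbreviation N :: int where "N \<equiv> int e * int n"

sublocale roots N
  using e_ge n_ge by unfold_locales simp

lemma two_n_le_N: "2 * int n \<le> N"
  using e_ge by (intro mult_right_mono) auto

lemma less_N: "k < 2 * int n \<Longrightarrow> k < N"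
  using order_less_le_trans[OF _ two_n_le_N] .

lemma mu_N: "mu (e * n) = range W"
  by (simp add: W_range mu_def nat_mult_distrib)

lemma mu_e: "mu e = range (\<lambda>t. W (t * int n))"
proof -
  interpret R: roots "int e" using e_ge by unfold_locales simp
  have "R.W t = W (t * int n)" for t using n_ge by (simp add: R.W_def W_def)
  then show ?thesis using R.W_range by (simp add: mu_def)
qed

lemma zero_notin_mu: "0 \<notin> mu (e * n)"
  using e_ge n_ge by (simp add: mu_def power_0_left)

definition same :: "complex set set \<Rightarrow> int \<Rightarrow> int \<Rightarrow> bool" where
  "same v i j \<longleftrightarrow> (\<exists>P\<in>v. W i \<in> P \<and> W j \<in> P)"

definition block :: "(int \<Rightarrow> int \<Rightarrow> bool) \<Rightarrow> int \<Rightarrow> complex set" where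
  "block r i = W ` {j. r i j}"

lemma NCP_e1D:
  assumes "v \<in> NCP_e1 e n"
  shows "\<And>i. \<exists>P\<in>v. W i \<in> P" "\<And>P. P \<in> v \<Longrightarrow> P \<subseteq> range W" "{} \<notin> v"
    and "\<And>P Q z. P \<in> v \<Longrightarrow> Q \<in> v \<Longrightarrow> z \<in> P \<Longrightarrow> z \<in> Q \<Longrightarrow> P = Q"
    and "\<And>P Q. P \<in> v \<Longrightarrow> Q \<in> v \<Longrightarrow> P \<noteq> Q \<Longrightarrow> convex hull P \<inter> convex hull Q = {}"
    and "\<And>P t. P \<in> v \<Longrightarrow> (\<lambda>z. W (t * int n) * z) ` P \<in> v"
proof -
  have e1: "v \<in> NCP (mu (e * n)) \<and> (\<forall>\<zeta>\<in>mu e. (\<lambda>P. (\<lambda>z. \<zeta> * z) ` P) ` v = v)"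
    using assms unfolding NCP_e1_def by (rule CollectD)
  have nc: "partition_on (range W) v \<and>
      (\<forall>P\<in>v. \<forall>Q\<in>v. convex hull P \<inter> convex hull Q \<noteq> {} \<longrightarrow> P = Q)"
    using conjunct1[OF e1] unfolding NCP_def mu_N by (rule CollectD)
  then have p: "partition_on (range W) v" by (rule conjunct1)
  have U: "range W = \<Union> v" by (rule partition_onD1[OF p])
  show "\<exists>P\<in>v. W i \<in> P" for i
  proof -
    have "W i \<in> \<Union> v" unfolding U[symmetric] by (rule rangeI)
    then show ?thesis by (rule UnionE) (rule bexI)
  qed
  show "P \<subseteq> range W" if "P \<in> v" for P unfolding U using that by (rule Union_upper)
  show "{} \<notin> v" using partition_onD3[OF p] .
  show "P = Q" if "P \<in> v" "Q \<in> v" "z \<in> P" "z \<in> Q" for P Q z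
    using partition_onD2[OF p] that unfolding disjoint_def by blast
  show "convex hull P \<inter> convex hull Q = {}" if "P \<in> v" "Q \<in> v" "P \<noteq> Q" for P Q
    using conjunct2[OF nc] that by metis
  show "(\<lambda>z. W (t * int n) * z) ` P \<in> v" if "P \<in> v" for P t
  proof -
    have "W (t * int n) \<in> mu e" unfolding mu_e by (rule rangeI)
    then have "(\<lambda>P. (\<lambda>z. W (t * int n) * z) ` P) ` v = v" using e1 by (elim conjE) (rule bspec)
    then show ?thesis using that by (metis imageI)
  qed
qed

lemma ncrel_same:
  assumes v: "v \<in> NCP_e1 e n"
  shows "ncrel (int e) (int n) (same v)"
proof
  show "2 \<le> int e" "0 < int n" using e_ge n_ge by auto
  show "same v i i" for i using NCP_e1D(1)[OF v] by (auto simp: same_def)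
  show "same v i j \<Longrightarrow> same v j i" for i j by (auto simp: same_def)
  show "same v i j \<Longrightarrow> same v j k \<Longrightarrow> same v i k" for i j k
    using NCP_e1D(4)[OF v] unfolding same_def by metis
  show "same v i (i + int e * int n)" for i
    using NCP_e1D(1)[OF v, of i] W_period[of i 1] by (auto simp: same_def)
  show "same v (i + int n) (j + int n)" if ij: "same v i j" for i j
  proof -
    obtain P where "P \<in> v" "W i \<in> P" "W j \<in> P" using ij by (auto simp: same_def)
    moreover have "W (k + int n) = W (1 * int n) * W k" for k by (simp add: W_add)
    ultimately show ?thesis using NCP_e1D(6)[OF v, of P 1] unfolding same_def
      by (intro bexI[of _ "(\<lambda>z. W (1 * int n) * z) ` P"]) blast+
  qed
  fix a b c d assume o: "a < b" "b < c" "c < d" "d < a + int e * int n" and "same v a c" "same v b d"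
  then obtain P Q where P: "P \<in> v" "W a \<in> P" "W c \<in> P" and Q: "Q \<in> v" "W b \<in> Q" "W d \<in> Q"
    by (auto simp: same_def)
  have "convex hull {W a, W c} \<subseteq> convex hull P" "convex hull {W b, W d} \<subseteq> convex hull Q"
    using P Q by (auto intro!: hull_mono)
  then have "convex hull P \<inter> convex hull Q \<noteq> {}" using W_chords_intersect[OF o] by blast
  then have "P = Q" using NCP_e1D(5)[OF v] P Q by blast
  then show "same v a b" using P Q by (auto simp: same_def)
qed

section \<open>From relations back to partitions\<close>

context
  fixes r assumes r: "ncrel (int e) (int n) r"
begin

interpretation ncrel "int e" "int n" r by (rule r)

lemma W_in_block: "W k \<in> block r i \<longleftrightarrow> r i k"
proof
  assume "W k \<in> block r i"
  then obtain j where j: "r i j" "W k = W j" by (auto simp: block_def)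
  then obtain m where "j = k + m * N" using W_eq_iff by blast
  then show "r i k" using j r_period_mult r_sym r_trans by blast
qed (auto simp: block_def)

lemma block_eq_iff: "block r i = block r j \<longleftrightarrow> r i j"
proof
  assume "block r i = block r j"
  then have "W j \<in> block r i" using W_in_block r_refl by blast
  then show "r i j" by (simp add: W_in_block)
next
  assume "r i j"
  then have "r i k \<longleftrightarrow> r j k" for k using r_sym r_trans by blast
  then show "block r i = block r j" by (simp add: block_def)
qed

text \<open>In the turn starting at \<open>i\<close>, the first and last relatives \<open>b\<close>
  and \<open>c\<close> of \<open>j\<close> bound an arc that holds the whole part of
  \<open>j\<close>. A relative \<open>k\<close> of \<open>i\<close> inside it would give the
  crossing \<open>i < b < k < c\<close>, so the part of \<open>i\<close> lies on the complementary
  arc.\<close>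

lemma blocks_hulls_disjoint:
  assumes "\<not> r i j"
  shows "convex hull block r i \<inter> convex hull block r j = {}"
proof -
  define B where "B = {k \<in> {i..<i + N}. r j k}"
  obtain m where m: "i \<le> j + m * N" "j + m * N < i + N" by (rule translate)
  have "j + m * N \<in> B" using m by (simp add: B_def r_period_iff r_refl)
  moreover have fin: "finite B" by (rule finite_subset[of _ "{i..<i+N}"]) (auto simp: B_def)
  ultimately have "B \<noteq> {}" by blast
  then have mem: "Min B \<in> B" "Max B \<in> B" using fin by auto
  define b c where "b = Min B" and "c = Max B"
  have B: "b \<le> k \<and> k \<le> c" if "k \<in> B" for k using that fin by (simp add: b_def c_def)
  have rb: "r j b" "r j c" "i \<le> b" "c < i + N" using mem by (auto simp: B_def b_def c_def)
  have bc: "b \<le> c" using B mem b_def by blast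
  have "b \<noteq> i" using rb(1) assms r_sym by blast
  then have ib: "i < b" using rb(3) by linarith
  show ?thesis
  proof (rule arcs_hulls_disjoint[of b c])
    show "b \<le> c" "c < b + N" using bc rb by auto
    show "block r j \<subseteq> W ` {b..c}"
    proof
      fix z assume "z \<in> block r j"
      then obtain k where k: "z = W k" "r j k" by (auto simp: block_def)
      obtain m where m: "i \<le> k + m * N" "k + m * N < i + N" by (rule translate)
      have "k + m * N \<in> B" using m k by (simp add: B_def r_period_iff)
      then show "z \<in> W ` {b..c}" using B k(1) W_period[of k m] by (intro image_eqI[of _ _ "k + m * N"]) auto
    qed
    show "block r i \<subseteq> W ` {c<..<b + N}"
    proof
      fix z assume "z \<in> block r i"
      then obtain k0 where k0: "z = W k0" "r i k0" by (auto simp: block_def)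
      obtain m where m: "b \<le> k0 + m * N" "k0 + m * N < b + N" by (rule translate)
      define k where "k = k0 + m * N"
      have k: "r i k" "z = W k" using k0 by (simp_all add: k_def r_period_iff W_period)
      have "\<not> k \<le> c"
      proof
        assume "k \<le> c"
        then consider "k = b" | "k = c" | "b < k" "k < c" using m k_def by linarith
        then show False
        proof cases
          case 1
          then show False using k(1) assms r_trans[OF _ r_sym[OF rb(1)]] by blast
        next
          case 2
          then show False using k(1) assms r_trans[OF _ r_sym[OF rb(2)]] by blast
        next
          case 3
          have "r b c" using r_trans[OF r_sym[OF rb(1)] rb(2)] .
          then have "r i b" using r_cross[OF ib 3 _ k(1)] rb(4) by blast
          then show False using assms r_trans[OF _ r_sym[OF rb(1)]] by blast
        qed
      qed
      then show "z \<in> W ` {c<..<b + N}" using k m by (intro image_eqI[of _ _ k]) (auto simp: k_def)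
    qed
  qed
qed

lemma rotate_block: "(\<lambda>z. W (t * int n) * z) ` block r i = block r (i + t * int n)"
proof (intro equalityI subsetI)
  fix z assume "z \<in> (\<lambda>z. W (t * int n) * z) ` block r i"
  then obtain j where "r i j" "z = W (t * int n) * W j" by (auto simp: block_def)
  then have "z = W (j + t * int n)" "r (i + t * int n) (j + t * int n)"
    by (simp_all add: W_add r_shift_mult)
  then show "z \<in> block r (i + t * int n)" by (simp add: W_in_block)
next
  fix z assume "z \<in> block r (i + t * int n)"
  then obtain j where j: "r (i + t * int n) j" "z = W j" by (auto simp: block_def)
  then have "r i (j - t * int n)" using r_shift_mult[of i t "j - t * int n"] by simp
  moreover have "z = W (t * int n) * W (j - t * int n)" using j W_add[of "t * int n" "j - t * int n"] by simp
  ultimately show "z \<in> (\<lambda>z. W (t * int n) * z) ` block r i" by (auto simp: W_in_block)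
qed

lemma blocks_in_NCP_e1: "range (block r) \<in> NCP_e1 e n"
proof -
  have "partition_on (range W) (range (block r))"
  proof (rule partition_onI)
    show "\<Union> (range (block r)) = range W" using W_in_block r_refl by (auto simp: block_def)
    show "disjnt P Q" if PQ: "P \<in> range (block r)" "Q \<in> range (block r)" "P \<noteq> Q" for P Q
    proof -
      obtain i j where ij: "P = block r i" "Q = block r j" using PQ by auto
      then have "\<not> r i j" using PQ block_eq_iff by blast
      then have "\<not> (r i k \<and> r j k)" for k using r_sym r_trans by blast
      then show ?thesis using ij W_in_block by (auto simp: disjnt_def block_def)
    qed
    show "{} \<notin> range (block r)" using r_refl by (auto simp: block_def)
  qed
  moreover have "P = Q" if "P \<in> range (block r)" "Q \<in> range (block r)"
    "convex hull P \<inter> convex hull Q \<noteq> {}" for P Q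
    using that blocks_hulls_disjoint block_eq_iff by blast
  moreover have "(\<lambda>P. (\<lambda>z. W (t * int n) * z) ` P) ` range (block r) = range (block r)" for t
  proof -
    have "(\<lambda>P. (\<lambda>z. W (t * int n) * z) ` P) ` range (block r) = range (\<lambda>i. block r (i + t * int n))"
      by (simp add: image_image rotate_block)
    also have "\<dots> = range (block r)"
    proof (intro equalityI subsetI)
      fix P assume "P \<in> range (block r)"
      then obtain i where "P = block r (i - t * int n + t * int n)" by auto
      then show "P \<in> range (\<lambda>i. block r (i + t * int n))" by blast
    qed blast
    finally show ?thesis .
  qed
  ultimately show ?thesis by (auto simp: NCP_e1_def NCP_def mu_N mu_e)
qed

lemma same_blocks: "same (range (block r)) = r"
proof (intro ext iffI)
  fix i j assume "same (range (block r)) i j"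
  then obtain k where "r k i" "r k j" by (auto simp: same_def W_in_block)
  then show "r i j" using r_sym r_trans by blast
next
  fix i j assume "r i j"
  then show "same (range (block r)) i j" using r_refl[of i] by (auto simp: same_def W_in_block)
qed

end

lemma block_same:
  assumes v: "v \<in> NCP_e1 e n" and P: "P \<in> v" "W i \<in> P"
  shows "block (same v) i = P"
proof
  show "block (same v) i \<subseteq> P" using P NCP_e1D(4)[OF v] by (fastforce simp: block_def same_def)
  show "P \<subseteq> block (same v) i" using P NCP_e1D(2)[OF v] by (fastforce simp: block_def same_def)
qed

lemma blocks_same:
  assumes v: "v \<in> NCP_e1 e n"
  shows "range (block (same v)) = v"
proof
  show "range (block (same v)) \<subseteq> v" using NCP_e1D(1)[OF v] block_same[OF v] by fastforce
  show "v \<subseteq> range (block (same v))"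
  proof
    fix P assume P: "P \<in> v"
    then have "P \<noteq> {}" "P \<subseteq> range W" using NCP_e1D(2,3)[OF v] by blast+
    then obtain i where "W i \<in> P" by blast
    then show "P \<in> range (block (same v))" using block_same[OF v P] by blast
  qed
qed

lemma bij_betw_same: "bij_betw same (NCP_e1 e n) {r. ncrel (int e) (int n) r}"
  by (rule bij_betw_byWitness[where f' = "\<lambda>r. range (block r)"])
    (auto simp: blocks_same same_blocks ncrel_same blocks_in_NCP_e1)

lemma bij_betw_word: "bij_betw (word_of_rel (int n) \<circ> same) (NCP_e1 e n) (balanced_words (int n))"
  by (rule bij_betw_trans[OF bij_betw_same]) (rule bij_betw_word_of_rel, use e_ge n_ge in auto)

lemma card_NCP_e1: "card (NCP_e1 e n) = (2 * n) choose n"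
  using bij_betw_same_card[OF bij_betw_word] card_balanced_words by simp

lemma finite_NCP_e1: "finite (NCP_e1 e n)"
  using card_NCP_e1 by (intro card_ge_0_finite) simp

text \<open>The gap right after \<open>p\<close> is not cut off from the origin by any link. For a
  noncrossing relation this is minimality of its nesting level, by
  \<open>minimal_gap_iff\<close>.\<close>

definition gap_free :: "(int \<Rightarrow> int \<Rightarrow> bool) \<Rightarrow> int \<Rightarrow> bool" where
  "gap_free r p \<longleftrightarrow> (\<forall>a b. a \<le> p \<longrightarrow> p < b \<longrightarrow> b \<le> a + int n \<longrightarrow> \<not> r a b)"

text \<open>The parts of a partition to which the point 0 can be attached;
  the empty set stands for making 0 a part of its own.\<close>

definition attach :: "complex set set \<Rightarrow> complex set set" where
  "attach v = {P \<in> insert {} v. \<forall>Q\<in>v. Q \<noteq> P \<longrightarrow> convex hull (insert 0 P) \<inter> convex hull Q = {}}"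

text \<open>Used to place 0 in the hull of a central part as the barycentre of an orbit. It is a
  geometric sum whose ratio differs from 1 because \<open>e \<ge> 2\<close>.\<close>

lemma sum_rotations: "(\<Sum>t<e. W (int t * int n)) = 0"
proof -
  have pow: "W (int t * int n) = W (int n) ^ t" for t
  proof (induction t)
    case 0 then show ?case by (simp add: W_def)
  next
    case (Suc t)
    have "W (int (Suc t) * int n) = W (int n + int t * int n)" by (simp add: algebra_simps)
    then show ?case using Suc W_add by simp
  qed
  have "W (int n) \<noteq> 1"
  proof
    assume "W (int n) = 1"
    then have "W 0 = W (int n)" by (simp add: W_def)
    then obtain k where "int n = 0 + k * N" using W_eq_iff by blast
    then have "int n * 1 = int n * (k * int e)" by (simp add: algebra_simps)
    then have "1 = k * int e" using n_ge by (simp only: mult_cancel_left) simp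
    then have "int e dvd 1" by (metis dvd_triv_right)
    then show False using e_ge by simp
  qed
  moreover have "W (int n) ^ e = 1"
    using pow[of e] W_period[of 0 1] by (simp add: W_def)
  ultimately show ?thesis using power_diff_1_eq[of "W (int n)" e] by (simp add: pow)
qed

section \<open>Counting the parts that the origin can join\<close>

context
  fixes v assumes v: "v \<in> NCP_e1 e n"
begin

interpretation ncrel "int e" "int n" "same v" by (rule ncrel_same[OF v])

text \<open>Both sides are 1. The part \<open>Z\<close> of \<open>a\<close> contains a full orbit,
  hence 0 lies in its hull and every other choice meets it; and the translates of the link from
  \<open>a\<close> to \<open>a + n\<close> pass over every gap.\<close>

lemma card_attach_central:
  assumes central: "same v a (a + int n)"
  shows "card (attach v) = 1 + card {p \<in> {0..<N}. gap_free (same v) p}"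
proof -
  obtain Z where Z: "Z \<in> v" "W a \<in> Z" using NCP_e1D(1)[OF v] by blast
  have orbit: "same v a (a + int t * int n)" for t
  proof (induction t)
    case (Suc t)
    have "same v (a + int t * int n) (a + int n + int t * int n)" using central by (simp add: r_shift_mult)
    then have "same v a (a + int n + int t * int n)" using Suc r_trans by blast
    then show ?case by (simp add: algebra_simps)
  qed (simp add: r_refl)
  have "W (a + int t * int n) \<in> Z" for t
    using orbit[of t] W_in_block[OF ncrel_same[OF v]] block_same[OF v Z] by blast
  then have "(\<Sum>t<e. (1 / real e) *\<^sub>R W (a + int t * int n)) \<in> convex hull Z"
    using e_ge by (intro convex_sum) (auto intro: hull_inc)
  moreover have "(\<Sum>t<e. (1 / real e) *\<^sub>R W (a + int t * int n)) = 0"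
  proof -
    have "(\<Sum>t<e. (1 / real e) *\<^sub>R W (a + int t * int n)) = (1 / real e) *\<^sub>R (W a * (\<Sum>t<e. W (int t * int n)))"
      by (simp only: scaleR_sum_right sum_distrib_left W_add)
    then show ?thesis using sum_rotations by simp
  qed
  ultimately have zero: "0 \<in> convex hull Z" by simp
  have "attach v = {Z}"
  proof (intro equalityI subsetI)
    fix P assume "P \<in> attach v"
    moreover have "0 \<in> convex hull (insert 0 P)" by (simp add: hull_inc)
    ultimately show "P \<in> {Z}" using zero Z by (auto simp: attach_def)
  next
    fix P assume "P \<in> {Z}"
    moreover have "convex hull (insert 0 Z) = convex hull Z" using zero by (rule hull_redundant)
    ultimately show "P \<in> attach v" using Z NCP_e1D(5)[OF v] by (auto simp: attach_def)
  qed
  moreover have "\<not> gap_free (same v) p" for p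
  proof -
    define k where "k = (p - a) div int n"
    have "p - a - k * int n = (p - a) mod int n"
      unfolding k_def using minus_div_mult_eq_mod[of "p - a" "int n"] by simp
    then have "a + k * int n \<le> p" "p < a + k * int n + int n"
      using pos_mod_bound[OF n_pos, of "p - a"] pos_mod_sign[OF n_pos, of "p - a"] by linarith+
    moreover have "same v (a + k * int n) (a + k * int n + int n)"
      using central r_shift_mult[of a k "a + int n"] by (simp add: algebra_simps)
    ultimately show ?thesis unfolding gap_free_def by blast
  qed
  ultimately show ?thesis by simp
qed

context
  assumes noncentral: "\<And>a. \<not> same v a (a + int n)"
begin

text \<open>Here \<open>b\<close> and \<open>c\<close> are the extreme relatives closer than
  \<open>n\<close> to \<open>i\<close>. If they were more than \<open>n\<close> apart, the shifted
  pair \<open>b + n\<close>, \<open>i + n\<close> would cross \<open>i\<close>, \<open>c\<close> and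
  make the part central. Relatives further away are excluded by \<open>r_far\<close>, up to full
  turns.\<close>

lemma window:
  obtains b c where "b \<le> c" "c < b + int n" "same v i b" "same v b c" "block (same v) i \<subseteq> W ` {b..c}"
proof -
  define B where "B = {k \<in> {i - int n<..<i + int n}. same v i k}"
  have fin: "finite B" by (rule finite_subset[of _ "{i - int n<..<i + int n}"]) (auto simp: B_def)
  have iB: "i \<in> B" using n_pos r_refl by (simp add: B_def)
  then have "B \<noteq> {}" by blast
  then have mem: "Min B \<in> B" "Max B \<in> B" using fin by auto
  define b c where "b = Min B" and "c = Max B"
  have B: "b \<le> k \<and> k \<le> c" if "k \<in> B" for k using that fin by (simp add: b_def c_def)
  have bc: "same v i b" "same v i c" "i - int n < b" "c < i + int n"
    using mem by (auto simp: B_def b_def c_def)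
  have bic: "b \<le> i" "i \<le> c" using B iB by auto
  have "c < b + int n"
  proof (rule ccontr)
    assume c: "\<not> c < b + int n"
    have "same v (b + int n) (i + int n)" using bc r_sym r_shift by blast
    moreover have rbc: "same v b c" using bc r_sym r_trans by blast
    then have "c \<noteq> b + int n" using noncentral by blast
    then have "b + int n < c" using c by linarith
    moreover have "i < b + int n" "c < i + int n" using bc by linarith+
    moreover have "i + int n < i + N" using n_pos by (intro less_add_period) simp
    ultimately have "same v i (b + int n)"
      using r_cross[of i "b + int n" c "i + int n"] bc(2) by blast
    then have "same v b (b + int n)" by (rule r_trans[OF r_sym[OF bc(1)]])
    then show False using noncentral by blast
  qed
  moreover have "block (same v) i \<subseteq> W ` {b..c}"
  proof
    fix z assume "z \<in> block (same v) i"
    then obtain k0 where k0: "z = W k0" "same v i k0" by (auto simp: block_def)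
    obtain m where m: "i - int n \<le> k0 + m * N" "k0 + m * N < i - int n + N" by (rule translate)
    define k where "k = k0 + m * N"
    have k: "same v i k" "z = W k" using k0 by (simp_all add: k_def r_period_iff W_period)
    have "k \<noteq> i - int n" using noncentral[of "i - int n"] r_sym[OF k(1)] by auto
    moreover have "k < i + int n"
    proof (rule ccontr)
      assume "\<not> k < i + int n"
      then have "same v i (i + int n)" using m(2) by (intro r_far[OF k(1)]) (auto simp: k_def)
      then show False using noncentral by blast
    qed
    ultimately have "k \<in> B" using k m by (simp add: B_def k_def)
    then show "z \<in> W ` {b..c}" using B k by auto
  qed
  moreover have "same v b c" using bc r_sym r_trans by blast
  moreover have "b \<le> c" using bic by linarith
  ultimately show ?thesis using that[of b c] bc(1) by blast
qed

lemma last_exists: "\<exists>p. same v i p \<and> \<not> opn p"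
proof -
  obtain b c where bc: "b \<le> c" "c < b + int n" "same v i b" "same v b c" "block (same v) i \<subseteq> W ` {b..c}"
    by (rule window)
  have ic: "same v i c" using bc r_trans by blast
  moreover have "\<not> opn c"
  proof
    assume "opn c"
    then obtain j where j: "c < j" "j \<le> c + int n" "same v c j" by (auto simp: opn_def)
    then have "same v i j" using ic r_trans by blast
    then have "W j \<in> block (same v) i" by (simp add: block_def)
    then have "W j \<in> W ` {b..c}" using bc(5) by blast
    then obtain k where k: "b \<le> k" "k \<le> c" "W k = W j" by (metis atLeastAtMost_iff imageE)
    then obtain m where m: "j = k + m * N" using W_eq_iff by blast
    have "0 < m * N" using m j k by linarith
    then have "1 * N \<le> m * N" using N_pos by (intro mult_right_mono) (auto simp: zero_less_mult_iff)
    then have "2 * int n \<le> m * N" using two_n_le_N by (simp only: mult_1)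
    then show False using m k j bc by linarith
  qed
  ultimately show ?thesis by blast
qed

text \<open>Let \<open>p < q\<close> be two such elements of a turn. Since \<open>p\<close> has no
  successor, \<open>q\<close> is more than \<open>n\<close> away, and \<open>r_far\<close> pushes it
  into the last \<open>n\<close> places of the turn. Then \<open>p + N\<close> is a successor of
  \<open>q\<close>.\<close>

lemma last_unique:
  assumes "same v p q" "\<not> opn p" "\<not> opn q" "p \<in> {0..<N}" "q \<in> {0..<N}"
  shows "p = q"
proof -
  have no: False if pq: "same v p q" "\<not> opn p" "\<not> opn q" "p < q" "q < p + N" for p q
  proof -
    have "\<not> q \<le> p + int n" using pq(1,2,4) unfolding opn_def by blast
    then have "p + int n < q" by linarith
    have "p + N - int n < q"
    proof (rule ccontr)
      assume "\<not> p + N - int n < q"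
      then have "same v p (p + int n)" using \<open>p + int n < q\<close> by (intro r_far[OF pq(1)]) auto
      then show False using noncentral by blast
    qed
    moreover have "same v q (p + N)" using r_trans[OF r_sym[OF pq(1)] r_period] .
    moreover have "q < p + N" by (rule pq(5))
    ultimately have "q < p + N \<and> p + N \<le> q + int n \<and> same v q (p + N)" by linarith
    then show False using pq(3) unfolding opn_def by blast
  qed
  have lt: "p < q + N" "q < p + N" using assms(4,5) by auto
  show ?thesis
  proof (cases p q rule: linorder_cases)
    case less
    then show ?thesis using no[OF assms(1-3) _ lt(2)] by blast
  next
    case greater
    then show ?thesis using no[OF r_sym[OF assms(1)] assms(3,2) _ lt(1)] by blast
  qed
qed

lemma gap_free_not_opn: "gap_free (same v) p \<Longrightarrow> \<not> opn p"
  unfolding gap_free_def opn_def by blast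

lemma gap_free_shift:
  assumes "gap_free (same v) p"
  shows "gap_free (same v) (p + k * int n)"
  unfolding gap_free_def
proof (intro allI impI notI)
  fix a b assume ab: "a \<le> p + k * int n" "p + k * int n < b" "b \<le> a + int n" "same v a b"
  then have "same v (a - k * int n) (b - k * int n)"
    using r_shift_mult[of "a - k * int n" k "b - k * int n"] by simp
  then show False using assms[unfolded gap_free_def, rule_format, of "a - k * int n" "b - k * int n"] ab
    by simp
qed

lemma gap_free_period: "gap_free (same v) p \<Longrightarrow> gap_free (same v) (p + k * N)"
  using gap_free_shift[of p "k * int e"] by (simp add: mult.assoc)

text \<open>Another part lies on an arc from \<open>b\<close> to \<open>c\<close> shorter than half
  a turn. A gap-free relative of \<open>p\<close> cannot lie there, as the pair \<open>b\<close>,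
  \<open>c\<close> would pass over its gap. Any other relative \<open>k\<close> there lies between
  two consecutive copies of \<open>p\<close>, both outside the arc, so \<open>k\<close> and the
  later copy would cross \<open>b\<close>, \<open>c\<close>.\<close>

lemma attach_if_gap_free:
  assumes p: "gap_free (same v) p"
  shows "block (same v) p \<in> attach v"
proof -
  define P where "P = block (same v) p"
  have "P \<in> v" using blocks_same[OF v] P_def by blast
  moreover have "convex hull (insert 0 P) \<inter> convex hull Q = {}" if Q: "Q \<in> v" "Q \<noteq> P" for Q
  proof -
    obtain i where i: "Q = block (same v) i" using blocks_same[OF v] Q by blast
    have ip: "\<not> same v i p" using Q i block_eq_iff[OF ncrel_same[OF v]] P_def by blast
    obtain b c where bc: "b \<le> c" "c < b + int n" "same v i b" "same v b c" "Q \<subseteq> W ` {b..c}"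
      using window[of i] i by blast
    have ic: "same v i c" using bc r_trans by blast
    have sep: "\<not> (b \<le> q \<and> q \<le> c)" if q: "same v p q" "gap_free (same v) q" for q
    proof
      assume "b \<le> q \<and> q \<le> c"
      moreover have "q \<noteq> c" using q ic ip r_sym r_trans by blast
      ultimately show False using q(2)[unfolded gap_free_def, rule_format, of b c] bc by simp
    qed
    show ?thesis
    proof (rule arcs_hulls_disjoint_0)
      show "b \<le> c" "Q \<subseteq> W ` {b..c}" by (fact bc)+
      show "2 * (c - b) < N" using bc(2) by (intro less_N) arith
      show "P \<subseteq> W ` {c<..<b + N}"
      proof
        fix z assume "z \<in> P"
        then obtain k0 where k0: "z = W k0" "same v p k0" by (auto simp: block_def P_def)
        obtain m where m: "b \<le> k0 + m * N" "k0 + m * N < b + N" by (rule translate)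
        define k where "k = k0 + m * N"
        have k: "same v p k" "z = W k" using k0 by (simp_all add: k_def r_period_iff W_period)
        have "\<not> k \<le> c"
        proof
          assume kc: "k \<le> c"
          obtain l where l: "k \<le> p + l * N" "p + l * N < k + N" by (rule translate)
          define q where "q = p + l * N"
          have q: "same v p q" "gap_free (same v) q" "same v p (q + (-1) * N)" "gap_free (same v) (q + (-1) * N)"
            using r_period_mult[of p l] r_period_mult[of p "l - 1"] p gap_free_period[of p l] gap_free_period[of p "l - 1"]
            by (auto simp: q_def algebra_simps)
          have "c < q" using sep[OF q(1,2)] m l kc by (auto simp: k_def q_def)
          moreover have "q < b + N"
            using sep[OF q(3,4)] m l kc by (auto simp: k_def q_def)
          moreover have "k \<noteq> b" "k \<noteq> c" using k bc ic ip r_sym r_trans by blast+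
          moreover have "same v k q" using k q(1) r_sym r_trans by blast
          moreover have "b \<le> k" using m by (simp add: k_def)
          ultimately have "same v b k" using r_cross[of b k c q] bc kc by simp
          then show False using k bc ip r_sym r_trans by blast
        qed
        then show "z \<in> W ` {c<..<b + N}" using k m by (intro image_eqI[of _ _ k]) (auto simp: k_def)
      qed
    qed
  qed
  ultimately show ?thesis by (auto simp: attach_def P_def)
qed

text \<open>A link over the gap after \<open>p\<close> belongs to another part, as \<open>p\<close>
  has no successor. It subtends less than half a turn, so its chord meets the radius to
  \<open>W p\<close>, against the choice of the part.\<close>

lemma gap_free_if_attach:
  assumes "block (same v) p \<in> attach v" and p: "\<not> opn p"
  shows "gap_free (same v) p"
  unfolding gap_free_def
proof (intro allI impI notI)
  fix a b assume ab: "a \<le> p" "p < b" "b \<le> a + int n" "same v a b"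
  have "b \<le> p + int n" using ab(1,3) by linarith
  then have "\<not> same v p b" using p ab(2) unfolding opn_def by blast
  then have ap: "\<not> same v a p" using r_trans[OF r_sym ab(4)] by blast
  then have "a \<noteq> p" using r_refl by blast
  then have "a < p" using ab(1) by linarith
  have "b \<noteq> a + int n" using noncentral ab(4) by blast
  then have short: "2 * (b - a) < N" using ab(3) \<open>b \<noteq> a + int n\<close> by (intro less_N) arith
  have "block (same v) a \<noteq> block (same v) p" using ap block_eq_iff[OF ncrel_same[OF v]] by simp
  moreover have "block (same v) a \<in> v" using blocks_same[OF v] rangeI[of "block (same v)" a] by simp
  ultimately have disj: "convex hull (insert 0 (block (same v) p)) \<inter> convex hull block (same v) a = {}"
    using assms(1) by (simp add: attach_def)
  have "{0, W p} \<subseteq> insert 0 (block (same v) p)"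
    using r_refl[of p] by (simp add: W_in_block[OF ncrel_same[OF v]])
  then have 1: "convex hull {0, W p} \<subseteq> convex hull (insert 0 (block (same v) p))"
    by (rule hull_mono)
  have "{W a, W b} \<subseteq> block (same v) a"
    using r_refl[of a] ab(4) by (simp add: W_in_block[OF ncrel_same[OF v]])
  then have 2: "convex hull {W a, W b} \<subseteq> convex hull block (same v) a"
    by (rule hull_mono)
  show False using Int_mono[OF 1 2] W_radius_intersects_chord[OF \<open>a < p\<close> ab(2) short]
    unfolding disj by (simp add: subset_empty)
qed

lemma empty_attach: "{} \<in> attach v"
proof -
  have "convex hull {0} \<inter> convex hull Q = {}" if Q: "Q \<in> v" for Q
  proof -
    obtain i where i: "Q = block (same v) i" using blocks_same[OF v] Q by blast
    obtain b c where bc: "b \<le> c" "c < b + int n" "block (same v) i \<subseteq> W ` {b..c}"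
      by (rule window[of i])
    have "2 * (c - b) < N" using bc(2) by (intro less_N) arith
    then show ?thesis using arcs_hulls_disjoint_0[of b c Q "{}"] bc i by simp
  qed
  then show ?thesis by (simp add: attach_def)
qed

text \<open>Every part is represented by its unique last element in a turn, and it can receive 0
  exactly when the gap after that element is free. The extra 1 is the empty choice.\<close>

lemma card_attach_noncentral: "card (attach v) = 1 + card {p \<in> {0..<N}. gap_free (same v) p}"
proof -
  have fin: "finite {p \<in> {0..<N}. gap_free (same v) p}"
    by (rule finite_subset[of _ "{0..<N}"]) auto
  have "attach v = insert {} (block (same v) ` {p \<in> {0..<N}. gap_free (same v) p})"
  proof (intro equalityI subsetI)
    fix P assume P: "P \<in> attach v"
    show "P \<in> insert {} (block (same v) ` {p \<in> {0..<N}. gap_free (same v) p})"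
    proof (cases "P = {}")
      case False
      then have "P \<in> range (block (same v))" using P blocks_same[OF v] by (simp add: attach_def)
      then obtain i where i: "P = block (same v) i" by blast
      obtain p0 where p0: "same v i p0" "\<not> opn p0" using last_exists by blast
      obtain m where m: "0 \<le> p0 + m * N" "p0 + m * N < 0 + N" by (rule translate)
      define p where "p = p0 + m * N"
      have "same v i p" using p0 by (simp add: p_def r_period_iff)
      then have "P = block (same v) p" using i block_eq_iff[OF ncrel_same[OF v]] by blast
      moreover have "\<not> opn p"
        using p0(2) opn_shift_mult[of p0 "m * int e"] by (simp add: p_def mult.assoc)
      ultimately have "gap_free (same v) p" using gap_free_if_attach P by blast
      then show ?thesis using \<open>P = block (same v) p\<close> m by (auto simp: p_def)
    qed simp
  next
    fix P assume "P \<in> insert {} (block (same v) ` {p \<in> {0..<N}. gap_free (same v) p})"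
    then show "P \<in> attach v" using empty_attach attach_if_gap_free by auto
  qed
  moreover have "inj_on (block (same v)) {p \<in> {0..<N}. gap_free (same v) p}"
  proof (rule inj_onI)
    fix p q assume pq: "p \<in> {p \<in> {0..<N}. gap_free (same v) p}" "q \<in> {p \<in> {0..<N}. gap_free (same v) p}"
      and "block (same v) p = block (same v) q"
    then have "same v p q" using block_eq_iff[OF ncrel_same[OF v]] by blast
    then show "p = q" using last_unique gap_free_not_opn pq by blast
  qed
  moreover have "{} \<notin> block (same v) ` {p \<in> {0..<N}. gap_free (same v) p}"
    using r_refl by (auto simp: block_def)
  ultimately show ?thesis using fin by (simp add: card_image)
qed

end

lemma card_attach: "card (attach v) = 1 + card {p \<in> {0..<N}. gap_free (same v) p}"
  using card_attach_central card_attach_noncentral by blast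

text \<open>Being gap-free is invariant under the shift by \<open>n\<close>, and a turn consists of
  \<open>e\<close> periods.\<close>

lemma card_gap_free:
  "card {p \<in> {0..<N}. gap_free (same v) p} = e * card (minimal_gaps (int n) (word_of_rel (int n) (same v)))"
proof -
  define G where "G = minimal_gaps (int n) (word_of_rel (int n) (same v))"
  have G: "p \<in> G \<longleftrightarrow> p \<in> {0..<int n} \<and> gap_free (same v) p" for p
    unfolding G_def minimal_gaps_def word_of_rel_def gap_free_def
    using minimal_gap_iff[of p] by simp
  have per: "gap_free (same v) (p + k * int n) \<longleftrightarrow> gap_free (same v) p" for p k
  proof -
    have "w.H (p + k * int n + 1) = w.H (p + 1)" using w.H_periodic[of "p + 1" k] by (simp add: algebra_simps)
    then show ?thesis using minimal_gap_iff[of p] minimal_gap_iff[of "p + k * int n"] by (simp add: gap_free_def)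
  qed
  have "bij_betw (\<lambda>(q, p). p + int q * int n) ({..<e} \<times> G) {p \<in> {0..<N}. gap_free (same v) p}"
  proof (rule bij_betw_byWitness[where f' = "\<lambda>p. (nat (p div int n), p mod int n)"])
    show "\<forall>x\<in>{..<e} \<times> G. (nat ((case x of (q, p) \<Rightarrow> p + int q * int n) div int n),
        (case x of (q, p) \<Rightarrow> p + int q * int n) mod int n) = x"
      using n_ge by (auto simp: G)
    show "\<forall>p\<in>{p \<in> {0..<N}. gap_free (same v) p}.
        (case (nat (p div int n), p mod int n) of (q, p) \<Rightarrow> p + int q * int n) = p"
      using n_ge by (auto simp: pos_imp_zdiv_nonneg_iff)
    show "(\<lambda>(q, p). p + int q * int n) ` ({..<e} \<times> G) \<subseteq> {p \<in> {0..<N}. gap_free (same v) p}"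
    proof clarsimp
      fix q p assume q: "q < e" and p: "p \<in> G"
      have "(int q + 1) * int n \<le> N" using q by (intro mult_right_mono) auto
      then show "0 \<le> p + int q * int n \<and> p + int q * int n < N \<and> gap_free (same v) (p + int q * int n)"
        using p per[of p "int q"] by (auto simp: G distrib_right)
    qed
    show "(\<lambda>p. (nat (p div int n), p mod int n)) ` {p \<in> {0..<N}. gap_free (same v) p} \<subseteq> {..<e} \<times> G"
    proof clarsimp
      fix p assume p: "0 \<le> p" "p < N" "gap_free (same v) p"
      have "p div int n < int e"
      proof (rule ccontr)
        assume "\<not> p div int n < int e"
        then have "N \<le> p div int n * int n" by (intro mult_right_mono) auto
        also have "\<dots> \<le> p" using pos_mod_sign[OF n_pos, of p] div_mult_mod_eq[of p "int n"] by linarith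
        finally show False using p(2) by simp
      qed
      then show "nat (p div int n) < e \<and> p mod int n \<in> G"
        using p per[of "p mod int n" "p div int n"] n_pos e_ge by (simp add: G nat_less_iff pos_imp_zdiv_nonneg_iff)
    qed
  qed
  then have "card ({..<e} \<times> G) = card {p \<in> {0..<N}. gap_free (same v) p}"
    by (rule bij_betw_same_card)
  then show ?thesis by (simp add: card_cartesian_product G_def)
qed

end

end

subsection \<open>Attaching the origin\<close>

text \<open>For \<open>P = {}\<close> nothing is removed from a partition and 0 becomes a part of
  its own, so one formula covers both kinds of choice in \<open>attach\<close>.\<close>

definition add_zero :: "complex set set \<Rightarrow> complex set \<Rightarrow> complex set set" where
  "add_zero v P = insert (insert 0 P) (v - {P})"

definition zero_part :: "complex set set \<Rightarrow> complex set" where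
  "zero_part u = \<Union>{P \<in> u. 0 \<in> P} - {0}"

lemma partition_add_zero:
  assumes "partition_on A v" "0 \<notin> A" "P \<in> insert {} v"
  shows "partition_on (insert 0 A) (add_zero v P)"
proof -
  have "P \<subseteq> A" using assms partition_onD1[OF assms(1)] by auto
  have dj: "Q \<inter> R = {}" if "Q \<in> v" "R \<in> v" "Q \<noteq> R" for Q R
    using partition_onD2[OF assms(1)] that by (auto simp: disjoint_def)
  have dP: "Q \<inter> P = {}" if "Q \<in> v" "Q \<noteq> P" for Q using dj[of Q P] that assms(3) by auto
  have nz: "0 \<notin> Q" if "Q \<in> v" for Q using assms(2) partition_onD1[OF assms(1)] that by auto
  show ?thesis
  proof (rule partition_onI)
    show "\<Union> (add_zero v P) = insert 0 A"
      using \<open>P \<subseteq> A\<close> partition_onD1[OF assms(1)] by (auto simp: add_zero_def)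
    show "disjnt Q R" if "Q \<in> add_zero v P" "R \<in> add_zero v P" "Q \<noteq> R" for Q R
      using that dj[of Q R] dP[of Q] dP[of R] nz[of Q] nz[of R] by (auto simp: add_zero_def disjnt_def)
    show "{} \<notin> add_zero v P" using partition_onD3[OF assms(1)] by (auto simp: add_zero_def)
  qed
qed

lemma restrict_add_zero:
  assumes "partition_on A v" "0 \<notin> A" "P \<in> insert {} v"
  shows "restrict_partition (add_zero v P) A = v"
proof -
  have "Q \<inter> A = Q" if "Q \<in> v" for Q using partition_onD1[OF assms(1)] that by auto
  then have "(\<lambda>Q. Q \<inter> A) ` (v - {P}) = v - {P}" by force
  moreover have "insert 0 P \<inter> A = P" using assms partition_onD1[OF assms(1)] by auto
  ultimately show ?thesis using assms(3) partition_onD3[OF assms(1)]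
    by (auto simp: restrict_partition_def add_zero_def)
qed

lemma zero_part_add_zero:
  assumes "partition_on A v" "0 \<notin> A" "P \<in> insert {} v"
  shows "zero_part (add_zero v P) = P"
proof -
  have nz: "0 \<notin> Q" if "Q \<in> v" for Q using assms(2) partition_onD1[OF assms(1)] that by auto
  then have "{Q \<in> add_zero v P. 0 \<in> Q} = {insert 0 P}" by (auto simp: add_zero_def)
  then show ?thesis using nz assms(3) by (auto simp: zero_part_def)
qed

lemma add_zero_zero_part:
  assumes u: "partition_on (insert 0 A) u" and A: "0 \<notin> A"
  shows "zero_part u \<in> insert {} (restrict_partition u A)"
    and "add_zero (restrict_partition u A) (zero_part u) = u"
    and "insert 0 (zero_part u) \<in> u"
    and "restrict_partition u A - {zero_part u} \<subseteq> u - {insert 0 (zero_part u)}"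
proof -
  obtain P0 where P0: "P0 \<in> u" "0 \<in> P0" using partition_onD1[OF u] by blast
  have dj: "Q = R" if "Q \<in> u" "R \<in> u" "z \<in> Q" "z \<in> R" for Q R z
    using partition_onD2[OF u] that unfolding disjoint_def by blast
  have ne: "{} \<notin> u" by (rule partition_onD3[OF u])
  have "{P \<in> u. 0 \<in> P} = {P0}" using P0 dj by blast
  then have zp: "zero_part u = P0 - {0}" by (simp add: zero_part_def)
  have sub: "Q \<subseteq> insert 0 A" if "Q \<in> u" for Q using partition_onD1[OF u] that by blast
  have P0A: "P0 \<inter> A = P0 - {0}" using sub[OF P0(1)] A by blast
  have QA: "Q \<inter> A = Q" if "Q \<in> u" "Q \<noteq> P0" for Q
    using sub[OF that(1)] dj[OF that(1) P0(1) _ P0(2)] that(2) by blast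
  have im: "(\<lambda>Q. Q \<inter> A) ` (u - {P0}) = u - {P0}" using QA by force
  have "(\<lambda>Q. Q \<inter> A) ` u = insert (P0 - {0}) (u - {P0})"
  proof -
    have "u = insert P0 (u - {P0})" using P0(1) by blast
    then have "(\<lambda>Q. Q \<inter> A) ` u = insert (P0 \<inter> A) ((\<lambda>Q. Q \<inter> A) ` (u - {P0}))"
      by (metis image_insert)
    then show ?thesis unfolding im P0A .
  qed
  then have res: "restrict_partition u A = insert (P0 - {0}) (u - {P0}) - {{}}"
    by (simp add: restrict_partition_def)
  \<comment> \<open>Otherwise deleting the restricted part of 0 from the restriction would also
    delete a genuine part of \<open>u\<close>.\<close>
  have notin: "P0 - {0} \<notin> u - {P0}"
  proof
    assume a: "P0 - {0} \<in> u - {P0}"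
    then have "P0 - {0} \<noteq> {}" using ne by (metis DiffD1)
    then obtain z where "z \<in> P0 - {0}" by blast
    then show False using dj[of "P0 - {0}" P0 z] a P0 by blast
  qed
  have ins: "insert 0 (P0 - {0}) = P0" using P0 by blast
  have diff: "restrict_partition u A - {P0 - {0}} = u - {P0}"
    using notin ne unfolding res by blast
  show "zero_part u \<in> insert {} (restrict_partition u A)" unfolding zp res by blast
  show "add_zero (restrict_partition u A) (zero_part u) = u"
    unfolding zp add_zero_def diff ins using P0(1) by blast
  show "insert 0 (zero_part u) \<in> u" unfolding zp ins by (rule P0(1))
  show "restrict_partition u A - {zero_part u} \<subseteq> u - {insert 0 (zero_part u)}"
    unfolding zp diff ins by simp
qed

context ncp
begin

lemma card_sum_attach: "(\<Sum>v\<in>NCP_e1 e n. card (attach v)) = ((2 * n) choose n) + e * ((2 * n) choose (n - 1))"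
proof -
  let ?w = "word_of_rel (int n) \<circ> same"
  have fin: "finite (balanced_words (int n))"
    using bij_betw_finite[OF bij_betw_word] finite_NCP_e1 by blast
  have "(\<Sum>v\<in>NCP_e1 e n. card (attach v)) = (\<Sum>v\<in>NCP_e1 e n. 1 + e * card (minimal_gaps (int n) (?w v)))"
    by (intro sum.cong refl) (simp only: card_attach card_gap_free comp_def)
  also have "\<dots> = (\<Sum>w\<in>balanced_words (int n). 1 + e * card (minimal_gaps (int n) w))"
    by (rule sum.reindex_bij_betw[OF bij_betw_word])
  also have "\<dots> = card (balanced_words (int n)) + e * (\<Sum>w\<in>balanced_words (int n). card (minimal_gaps (int n) w))"
    by (simp only: sum.distrib sum_distrib_left card_eq_sum)
  also have "(\<Sum>w\<in>balanced_words (int n). card (minimal_gaps (int n) w))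
      = card (SIGMA w:balanced_words (int n). minimal_gaps (int n) w)"
  proof (rule card_SigmaI[symmetric])
    show "\<forall>w\<in>balanced_words (int n). finite (minimal_gaps (int n) w)"
      by (auto simp: minimal_gaps_def split: prod.splits intro: finite_subset[of _ "{0..<int n}"])
  qed (rule fin)
  also have "\<dots> = card (excess_words (int n))"
    by (rule bij_betw_same_card[OF bij_betw_minimal_gaps]) (use n_ge in simp)
  finally show ?thesis using n_ge by (simp add: card_balanced_words card_excess_words)
qed

lemma bij_betw_add_zero:
  "bij_betw (\<lambda>(v, P). add_zero v P) (SIGMA v:NCP_e1 e n. attach v) (NCP_ee e n)"
proof (rule bij_betw_byWitness[where f' = "\<lambda>u. (restrict_partition u (mu (e * n)), zero_part u)"])
  let ?A = "mu (e * n)"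
  have part: "partition_on ?A v" if "v \<in> NCP_e1 e n" for v
    using that by (simp add: NCP_e1_def NCP_def)
  have att: "P \<in> insert {} v" if "P \<in> attach v" for v P
    using that by (simp add: attach_def)
  show "\<forall>x\<in>SIGMA v:NCP_e1 e n. attach v.
      (restrict_partition (case x of (v, P) \<Rightarrow> add_zero v P) ?A, zero_part (case x of (v, P) \<Rightarrow> add_zero v P)) = x"
  proof clarify
    fix v P assume v: "v \<in> NCP_e1 e n" and P: "P \<in> attach v"
    show "restrict_partition (add_zero v P) ?A = v \<and> zero_part (add_zero v P) = P"
      using restrict_add_zero[OF part[OF v] zero_notin_mu att[OF P]]
        zero_part_add_zero[OF part[OF v] zero_notin_mu att[OF P]] by simp
  qed
  have ee: "partition_on (insert 0 ?A) u" if "u \<in> NCP_ee e n" for u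
    using that by (simp add: NCP_ee_def NCP_def)
  show "\<forall>u\<in>NCP_ee e n. (case (restrict_partition u ?A, zero_part u) of (v, P) \<Rightarrow> add_zero v P) = u"
    using add_zero_zero_part(2)[OF ee zero_notin_mu] by simp
  show "(\<lambda>(v, P). add_zero v P) ` (SIGMA v:NCP_e1 e n. attach v) \<subseteq> NCP_ee e n"
  proof clarify
    fix v P assume v: "v \<in> NCP_e1 e n" and P: "P \<in> attach v"
    have z: "convex hull (insert 0 P) \<inter> convex hull Q = {}" if "Q \<in> v" "Q \<noteq> P" for Q
      using P that by (simp add: attach_def)
    have "Q = R" if Q: "Q \<in> add_zero v P" and R: "R \<in> add_zero v P"
      and m: "convex hull Q \<inter> convex hull R \<noteq> {}" for Q R
    proof (rule ccontr)
      assume "Q \<noteq> R"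
      then consider "Q \<in> v" "R \<in> v" | "Q = insert 0 P" "R \<in> v" "R \<noteq> P" | "R = insert 0 P" "Q \<in> v" "Q \<noteq> P"
        using Q R unfolding add_zero_def by blast
      then show False
      proof cases
        case 1 then show ?thesis using NCP_e1D(5)[OF v] \<open>Q \<noteq> R\<close> m by blast
      next
        case 2 then show ?thesis using z[of R] m by simp
      next
        case 3 then show ?thesis using z[of Q] m by (simp add: Int_commute)
      qed
    qed
    then have "add_zero v P \<in> NCP (?A \<union> {0})"
      using partition_add_zero[OF part[OF v] zero_notin_mu att[OF P]] by (simp add: NCP_def)
    then show "add_zero v P \<in> NCP_ee e n"
      using restrict_add_zero[OF part[OF v] zero_notin_mu att[OF P]] v by (simp add: NCP_ee_def)
  qed
  show "(\<lambda>u. (restrict_partition u ?A, zero_part u)) ` NCP_ee e n \<subseteq> (SIGMA v:NCP_e1 e n. attach v)"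
  proof clarify
    fix u assume u: "u \<in> NCP_ee e n"
    note zp = add_zero_zero_part[OF ee[OF u] zero_notin_mu]
    have sep: "convex hull Q \<inter> convex hull R = {}" if "Q \<in> u" "R \<in> u" "Q \<noteq> R" for Q R
      using u that unfolding NCP_ee_def NCP_def by blast
    have "convex hull (insert 0 (zero_part u)) \<inter> convex hull Q = {}"
      if "Q \<in> restrict_partition u ?A" "Q \<noteq> zero_part u" for Q
    proof (rule sep)
      show "insert 0 (zero_part u) \<in> u" by (rule zp(3))
      have "Q \<in> u - {insert 0 (zero_part u)}" using zp(4) that by blast
      then show "Q \<in> u" "insert 0 (zero_part u) \<noteq> Q" by auto
    qed
    then have "zero_part u \<in> attach (restrict_partition u ?A)"
      using zp(1) by (simp add: attach_def)
    moreover have "restrict_partition u ?A \<in> NCP_e1 e n" using u by (simp add: NCP_ee_def)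
    ultimately show "restrict_partition u ?A \<in> NCP_e1 e n \<and> zero_part u \<in> attach (restrict_partition u ?A)"
      by simp
  qed
qed

lemma card_NCP_ee: "card (NCP_ee e n) = ((2 * n) choose n) + e * ((2 * n) choose (n - 1))"
proof -
  have "finite (attach v)" if "v \<in> NCP_e1 e n" for v
    using card_attach[OF that] by (intro card_ge_0_finite) simp
  then have "card (SIGMA v:NCP_e1 e n. attach v) = (\<Sum>v\<in>NCP_e1 e n. card (attach v))"
    using finite_NCP_e1 by (intro card_SigmaI) auto
  then show ?thesis using bij_betw_same_card[OF bij_betw_add_zero] card_sum_attach by simp
qed

end

subsection \<open>Catalan numbers\<close>

text \<open>The factor \<open>e\<close> cancels, and the product of the \<open>(n + i) / i\<close>
  is \<open>fact (2 * n) / (fact n * fact n)\<close>.\<close>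

lemma prod_degrees:
  assumes "0 < e"
  shows "(\<Prod>i\<leftarrow>[1..<n + 1]. (of_nat (i * e + e * n) / of_nat (i * e) :: rat)) = of_nat ((2 * n) choose n)"
proof -
  have "(\<Prod>i\<leftarrow>[1..<n + 1]. (of_nat (i * e + e * n) / of_nat (i * e) :: rat))
      = (\<Prod>i = 1..n. of_nat (i * e + e * n) / of_nat (i * e))"
  proof -
    have s: "{1..n} = set [1..<n + 1]" by auto
    show ?thesis unfolding s by (rule prod.distinct_set_conv_list[symmetric]) simp
  qed
  also have "\<dots> = (\<Prod>i = 1..n. of_nat (n + i) / of_nat i)"
  proof (rule prod.cong)
    fix i assume "i \<in> {1..n}"
    have "of_nat (i * e + e * n) = (of_nat e * of_nat (n + i) :: rat)" by (simp add: algebra_simps)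
    moreover have "of_nat (i * e) = (of_nat e * of_nat i :: rat)" by simp
    ultimately show "(of_nat (i * e + e * n) / of_nat (i * e) :: rat) = of_nat (n + i) / of_nat i"
      using assms by simp
  qed simp
  also have "\<dots> = (\<Prod>i = 1..n. of_nat (n + i)) / fact n"
    by (simp add: prod_dividef fact_prod)
  also have "\<dots> = of_nat ((2 * n) choose n)"
  proof -
    have "fact n * (\<Prod>i = 1..m. of_nat (n + i)) = (fact (n + m) :: rat)" for m
    proof (induction m)
      case (Suc m)
      have "fact n * (\<Prod>i = 1..Suc m. of_nat (n + i))
          = of_nat (n + Suc m) * (fact n * (\<Prod>i = 1..m. of_nat (n + i)) :: rat)"
        by (simp add: mult_ac)
      also have "\<dots> = fact (n + Suc m)" by (simp only: Suc) simp
      finally show ?case .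
    qed simp
    from this[of n] have p: "fact (2 * n) = fact n * (\<Prod>i = 1..n. of_nat (n + i) :: rat)"
      by (simp only: mult_2)
    have "of_nat ((2 * n) choose n) = (fact (2 * n) / (fact n * fact n) :: rat)"
      using binomial_fact[of n "2 * n", where 'a = rat] by simp
    then show ?thesis unfolding p by simp
  qed
  finally show ?thesis .
qed

lemma Max_degrees_G_e1:
  assumes "1 \<le> n"
  shows "Max (set (degrees_G_e1 e n)) = e * n"
  using assms by (intro Max_eqI) (auto simp: degrees_G_e1_def image_iff mult.commute intro: bexI[of _ n])

lemma Max_degrees_G_ee:
  assumes "2 \<le> e" "1 \<le> n"
  shows "Max (set (degrees_G_ee e n)) = e * n"
proof (rule Max_eqI)
  \<comment> \<open>The additional degree \<open>n + 1\<close> must not exceed \<open>e * n\<close>;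
    this is where \<open>e \<ge> 2\<close> matters for the largest degree.\<close>
  have "n + 1 \<le> 2 * n" using assms by simp
  also have "\<dots> \<le> e * n" using assms by (intro mult_right_mono) auto
  finally have n1: "n + 1 \<le> e * n" .
  show "y \<le> e * n" if "y \<in> set (degrees_G_ee e n)" for y
    using that n1 by (auto simp: degrees_G_ee_def mult.commute)
  show "e * n \<in> set (degrees_G_ee e n)"
    using assms by (auto simp: degrees_G_ee_def image_iff mult.commute intro: bexI[of _ n])
qed simp

lemma catalan_G_e1:
  assumes "0 < e" "1 \<le> n"
  shows "catalan_of_degrees (degrees_G_e1 e n) = of_nat ((2 * n) choose n)"
  using prod_degrees[OF assms(1), of n] Max_degrees_G_e1[OF assms(2), of e]
  by (simp only: catalan_of_degrees_def) (simp add: degrees_G_e1_def comp_def del: of_nat_add of_nat_mult upt_Suc)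

lemma catalan_G_ee:
  assumes "2 \<le> e" "1 \<le> n"
  shows "catalan_of_degrees (degrees_G_ee e n) = of_nat (((2 * n) choose n) + e * ((2 * n) choose (n - 1)))"
proof -
  have "catalan_of_degrees (degrees_G_ee e n)
      = (\<Prod>i\<leftarrow>[1..<n + 1]. of_nat (i * e + e * n) / of_nat (i * e)) * (of_nat (n + 1 + e * n) / of_nat (n + 1))"
    unfolding catalan_of_degrees_def Max_degrees_G_ee[OF assms]
    by (simp add: degrees_G_ee_def comp_def del: of_nat_add of_nat_mult upt_Suc)
  also have "\<dots> = of_nat ((2 * n) choose n) * (of_nat (n + 1 + e * n) / of_nat (n + 1))"
    using assms by (subst prod_degrees) auto
  also have "\<dots> = of_nat (((2 * n) choose n) + e * ((2 * n) choose (n - 1)))"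
  proof -
    \<comment> \<open>The degree \<open>n + 1\<close> contributes the factor
      \<open>1 + e * n / (n + 1)\<close>; this identity turns its second summand into
      \<open>e * ((2 * n) choose (n - 1))\<close>.\<close>
    have "n * ((2 * n) choose n) = (n + 1) * ((2 * n) choose (n - 1))"
      using binomial_absorb_comp[of "2 * n" "n - 1"] binomial_absorption[of "n - 1" "2 * n"] assms
      by simp
    then have "of_nat (n * ((2 * n) choose n)) = (of_nat ((n + 1) * ((2 * n) choose (n - 1))) :: rat)"
      by (rule arg_cong)
    then show ?thesis by (simp add: field_simps)
  qed
  finally show ?thesis .
qed

theorem corollary8p2:
  fixes e n :: nat
  assumes "e \<ge> 2" and "n \<ge> 1"
  shows "of_nat (card (NCP_e1 e n)) = catalan_of_degrees (degrees_G_e1 e n)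
       \<and> of_nat (card (NCP_ee e n)) = catalan_of_degrees (degrees_G_ee e n)"
proof -
  interpret ncp e n using assms by unfold_locales
  show ?thesis using assms by (simp add: card_NCP_e1 card_NCP_ee catalan_G_e1 catalan_G_ee)
qed

end
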